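(* Let $0<a<1$, $0<\alpha\le 1$ and $N\ge 1$. With $(x_0,y_0)=\left(-1,-\frac{1-\alpha^2}{1+\alpha^2}\right)$ set $$P_-(z)=\prod_{j=0}^{N-1}\mathsf b(\sigma^j(x_0,y_0))\begin{pmatrix}\mathsf a(\sigma^j(x_0,y_0))&0\\0&1\end{pmatrix}\begin{pmatrix}1&1\\ \frac{a^2}{z}&1\end{pmatrix}\begin{pmatrix}1&0\\0&\mathsf a(\sigma^j(x_0,y_0))\end{pmatrix},$$ $$P_+(z)=\prod_{j=0}^{N-1}\begin{pmatrix}1&0\\0&\frac{a^2}{\alpha^2}\mathsf d(\sigma^{N-1-j}(x_0,y_0))\end{pmatrix}\begin{pmatrix}1&a^2z\\1&1\end{pmatrix}\begin{pmatrix}1&0\\0&\mathsf d(\sigma^{N-1-j}(x_0,y_0))\end{pmatrix}.$$ Then for all $x,x'\in\mathbb Z$, all integers $m,m'$ and all $\varepsilon,\varepsilon'\in\{0,1\}$ with $0\le 2m+\varepsilon\le 2N$ and $0\le 2m'+\varepsilon'\le 2N$, the correlation kernel $K_N$ satisfies $$\left[K_N((2m+\varepsilon,2x-j),(2m'+\varepsilon',2x'-j'))\right]_{j',j=0}^1=-\frac{\mathbf 1_{2m'+\varepsilon'<2m+\varepsilon}}{2\pi i}\oint_{|z|=1}A_o(z)^{-\varepsilon'}P(z)^{m-m'}A_o(z)^{\varepsilon}\,\frac{z^{m-x-m'+x'}}{(z-a^2)^{m-m'}}\frac{dz}{z}$$ $$+\frac1{(2\pi i)^2}\oint_{|w|=\rho_1}\oint_{|z|=\rho_2}A_o(w)^{-\varepsilon'}P(w)^{N-m'}P_+(w)^{-1}P_-(z)^{-1}P(z)^{m}A_o(z)^{\varepsilon}\,\frac{w^{x'+N-m'}(z-a^2)^{N-m}}{z^{x+N-m}(w-a^2)^{N-m'}}\frac{dz\,dw}{z(z-w)},$$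 where the circles are counterclockwise oriented and $a^2<\rho_1<\rho_2<1/a^2$.
   Context: Products of matrices are ordered left to right by increasing index. In matrices $[\,\cdot\,]_{j',j=0}^1$ the row index is $j'$ and the column index is $j$. Matrices: $A_o(z)=\begin{pmatrix}\alpha&a\alpha z\\ \frac a\alpha&\frac1\alpha\end{pmatrix}$, $A_e(z)=\frac1{1-a^2/z}\begin{pmatrix}1&a\\ \frac az&1\end{pmatrix}$, $P(z)=\begin{pmatrix}\alpha&a\alpha z\\ \frac a\alpha&\frac1\alpha\end{pmatrix}\begin{pmatrix}1&a\\ \frac az&1\end{pmatrix}$; $A_m=A_o$ for odd $m$, $A_m=A_e$ for even $m$. Kernel $K_N$: let $A(z)=\prod_{m=1}^{2N}A_m(z)$ and let $A(z)=A_-(z)A_+(z)$ be its Wiener-Hopf factorization, i.e. $A_\pm$ are $2\times2$ matrix functions, $A_+^{\pm1}$ analytic in $|z|<1$ and continuous in $|z|\le1$, $A_-^{\pm1}$ analytic in $|z|>1$ and continuous in $|z|\ge1$, and $A_-(z)\to I$ as $z\to\infty$ (both factors continue analytically to $a^2<|z|<a^{-2}$). Then $K_N$ is the function on $(\{0,\dots,2N\}\times\mathbb Z)^2$ given, for $m,m'\in\{0,\dots,2N\}$ and $x,x'\in\mathbb Z$, by $$[K_N((m,2x-j),(m',2x'-j'))]_{j',j=0}^1=-\frac{\mathbf 1_{m'<m}}{2\pi i}\oint_{|z|=1}\prod_{k=m'+1}^{m}A_k(z)\frac{dz}{z^{x-x'+1}}$$ $$+\frac1{(2\pi i)^2}\oint_{|w|=\rho_1}\oint_{|z|=\rho_2}\Big(\prod_{k=m'+1}^{2N}A_k(w)\Big)A_+(w)^{-1}A_-(z)^{-1}\Big(\prod_{k=1}^{m}A_k(z)\Big)\frac{w^{x'}}{z^{x+1}}\frac{dz\,dw}{z-w},$$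 with $a^2<\rho_1<\rho_2<1/a^2$ and counterclockwise circles. (It is the correlation kernel of the determinantal point process, given by non-intersecting paths, that encodes the biased $2\times2$ periodic Aztec diamond of size $N$.) Elliptic curve and flow: $\mathcal E$ is the real curve $y^2=x^2+\frac{4x(x-a^2)(x-1/a^2)}{(a+1/a)^2(\alpha+1/\alpha)^2}$, with $\mathcal E_-=\{(x,y)\in\mathcal E: x<0\}$. The map $\sigma:\mathcal E_-\to\mathcal E_-$ is addition of the point $(a^{-2},a^{-2})$ in the group law on $\mathcal E$ with the point at infinity as identity; concretely $\sigma(x,y)$ is the reflection in the $x$-axis of the third intersection point (counted with multiplicity) with $\mathcal E$ of the line through $(x,y)$ and $(a^{-2},a^{-2})$. $\sigma^j$ is the $j$-fold iterate. Functions $\mathcal E_-\to(0,\infty)$: $\mathsf a(x,y)=\frac{a(a^2+1)(\alpha^2+1)}2\,\frac{y-x}{1-a^2x}$, $\ \mathsf b(x,y)=-\frac1{\alpha a x}$, $\ \mathsf d(x,y)=\frac{2a\alpha x(x-1/a^2)}{(a^2+1)(\alpha+1/\alpha)(y-x)}$. *)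

theory Defs
  imports "HOL-Complex_Analysis.Complex_Analysis"
begin

section \<open>Matrices\<close>

text \<open>The elements of the index type \<open>2\<close> are \<open>1\<close> and \<open>2\<close> (with \<open>2 = 0\<close>), and \<open>vector\<close> enumerates
  them in this order. A row or column that is numbered \<open>j \<in> {0, 1}\<close> in the mathematics therefore
  has to be addressed as \<open>ix j\<close>, and not by the numeral \<open>j\<close>.\<close>

type_synonym cmat = "complex ^ 2 ^ 2"

definition ix :: "int \<Rightarrow> 2" where
  "ix j = (if j = 0 then 1 else 2)"

definition mat2 :: "complex \<Rightarrow> complex \<Rightarrow> complex \<Rightarrow> complex \<Rightarrow> cmat" where
  "mat2 p q r s = vector [vector [p, q], vector [r, s]]"

definition mscale :: "complex \<Rightarrow> cmat \<Rightarrow> cmat" (infixr "*m" 75) where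
  "c *m M = map_matrix ((*) c) M"

text \<open>Product over the list of indices, from left to right.\<close>

definition mprod :: "('i \<Rightarrow> cmat) \<Rightarrow> 'i list \<Rightarrow> cmat" where
  "mprod F ks = foldr (\<lambda>k M. F k ** M) ks (mat 1)"

definition mpowi :: "cmat \<Rightarrow> int \<Rightarrow> cmat" where
  "mpowi M k = (if 0 \<le> k then ((**) M ^^ nat k) (mat 1)
                else ((**) (matrix_inv M) ^^ nat (- k)) (mat 1))"

definition mat_holomorphic_on :: "(complex \<Rightarrow> cmat) \<Rightarrow> complex set \<Rightarrow> bool" where
  "mat_holomorphic_on F S \<longleftrightarrow> (\<forall>i j. (\<lambda>z. F z $ i $ j) holomorphic_on S)"

text \<open>Entrywise integral over the counterclockwise circle \<open>|z| = r\<close>.\<close>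

definition circle_int :: "real \<Rightarrow> (complex \<Rightarrow> cmat) \<Rightarrow> cmat" where
  "circle_int r F = (\<chi> i j. contour_integral (circlepath 0 r) (\<lambda>z. F z $ i $ j))"


section \<open>Transition matrices\<close>

definition A_odd :: "real \<Rightarrow> real \<Rightarrow> complex \<Rightarrow> cmat" where
  "A_odd a \<alpha> z = mat2 (of_real \<alpha>) (of_real (a * \<alpha>) * z) (of_real (a / \<alpha>)) (of_real (1 / \<alpha>))"

definition A_even_num :: "real \<Rightarrow> complex \<Rightarrow> cmat" where
  "A_even_num a z = mat2 1 (of_real a) (of_real a / z) 1"

definition A_even :: "real \<Rightarrow> complex \<Rightarrow> cmat" where
  "A_even a z = (1 / (1 - of_real (a\<^sup>2) / z)) *m A_even_num a z"

definition P_mat :: "real \<Rightarrow> real \<Rightarrow> complex \<Rightarrow> cmat" where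
  "P_mat a \<alpha> z = A_odd a \<alpha> z ** A_even_num a z"

definition A_step :: "real \<Rightarrow> real \<Rightarrow> int \<Rightarrow> complex \<Rightarrow> cmat" where
  "A_step a \<alpha> m z = (if odd m then A_odd a \<alpha> z else A_even a z)"

definition A_total :: "real \<Rightarrow> real \<Rightarrow> nat \<Rightarrow> complex \<Rightarrow> cmat" where
  "A_total a \<alpha> N z = mprod (\<lambda>m. A_step a \<alpha> m z) [1..2 * int N]"


section \<open>Wiener--Hopf factorization\<close>

definition annulus :: "real \<Rightarrow> complex set" where
  "annulus a = {z. a\<^sup>2 < cmod z \<and> cmod z < 1 / a\<^sup>2}"

text \<open>The last two conditions say that \<open>F\<close> and \<open>G\<close> stand for the analytic continuations of the
  factors \<open>A\<^sub>-\<close> and \<open>A\<^sub>+\<close>; the values of \<open>F\<close> on \<open>|z| \<le> a\<^sup>2\<close> and of \<open>G\<close> on \<open>|z| \<ge> a\<^sup>-\<^sup>2\<close> that this leaves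
  undetermined are not used by the kernel. On the remaining regions the factorization is unique.\<close>

definition wiener_hopf ::
    "real \<Rightarrow> (complex \<Rightarrow> cmat) \<Rightarrow> (complex \<Rightarrow> cmat) \<Rightarrow> (complex \<Rightarrow> cmat) \<Rightarrow> bool" where
  "wiener_hopf a A F G \<longleftrightarrow>
     (\<forall>z. cmod z = 1 \<longrightarrow> A z = F z ** G z) \<and>
     (\<forall>z. cmod z \<le> 1 \<longrightarrow> invertible (G z)) \<and>
     mat_holomorphic_on G {z. cmod z < 1} \<and> continuous_on {z. cmod z \<le> 1} G \<and>
     mat_holomorphic_on (\<lambda>z. matrix_inv (G z)) {z. cmod z < 1} \<and>
     continuous_on {z. cmod z \<le> 1} (\<lambda>z. matrix_inv (G z)) \<and>
     (\<forall>z. cmod z \<ge> 1 \<longrightarrow> invertible (F z)) \<and>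
     mat_holomorphic_on F {z. cmod z > 1} \<and> continuous_on {z. cmod z \<ge> 1} F \<and>
     mat_holomorphic_on (\<lambda>z. matrix_inv (F z)) {z. cmod z > 1} \<and>
     continuous_on {z. cmod z \<ge> 1} (\<lambda>z. matrix_inv (F z)) \<and>
     (F \<longlongrightarrow> mat 1) at_infinity \<and>
     mat_holomorphic_on F (annulus a) \<and>
     mat_holomorphic_on G (annulus a)"

definition wh_pair :: "real \<Rightarrow> real \<Rightarrow> nat \<Rightarrow> (complex \<Rightarrow> cmat) \<times> (complex \<Rightarrow> cmat)" where
  "wh_pair a \<alpha> N = (SOME (F, G). wiener_hopf a (A_total a \<alpha> N) F G)"

definition A_minus :: "real \<Rightarrow> real \<Rightarrow> nat \<Rightarrow> complex \<Rightarrow> cmat" where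
  "A_minus a \<alpha> N = fst (wh_pair a \<alpha> N)"

definition A_plus :: "real \<Rightarrow> real \<Rightarrow> nat \<Rightarrow> complex \<Rightarrow> cmat" where
  "A_plus a \<alpha> N = snd (wh_pair a \<alpha> N)"


section \<open>The correlation kernel\<close>

text \<open>The parameters \<open>r\<^sub>1\<close> and \<open>r\<^sub>2\<close> are the radii of the circles; the kernel is the same for all
  \<open>a\<^sup>2 < r\<^sub>1 < r\<^sub>2 < a\<^sup>-\<^sup>2\<close>.\<close>

definition kernel_block ::
    "real \<Rightarrow> real \<Rightarrow> nat \<Rightarrow> real \<Rightarrow> real \<Rightarrow> int \<Rightarrow> int \<Rightarrow> int \<Rightarrow> int \<Rightarrow> cmat" where
  "kernel_block a \<alpha> N r\<^sub>1 r\<^sub>2 m x m' x' =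
     - ((of_bool (m' < m) / (2 * of_real pi * \<i>)) *m
          circle_int 1 (\<lambda>z. (1 / z powi (x - x' + 1)) *m mprod (\<lambda>k. A_step a \<alpha> k z) [m' + 1..m]))
     + (1 / (2 * of_real pi * \<i>)\<^sup>2) *m
          circle_int r\<^sub>1 (\<lambda>w. circle_int r\<^sub>2 (\<lambda>z.
            (w powi x' / z powi (x + 1) * (1 / (z - w))) *m
              (mprod (\<lambda>k. A_step a \<alpha> k w) [m' + 1..2 * int N] **
               matrix_inv (A_plus a \<alpha> N w) ** matrix_inv (A_minus a \<alpha> N z) **
               mprod (\<lambda>k. A_step a \<alpha> k z) [1..m])))"

text \<open>Every integer \<open>u\<close> is \<open>2x - j\<close> for exactly one \<open>x\<close> and one \<open>j \<in> {0, 1}\<close>, namely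
  \<open>x = (u + 1) div 2\<close> and \<open>j = u mod 2\<close>. The column index belongs to the unprimed argument.\<close>

definition corr_kernel ::
    "real \<Rightarrow> real \<Rightarrow> nat \<Rightarrow> real \<Rightarrow> real \<Rightarrow> int \<times> int \<Rightarrow> int \<times> int \<Rightarrow> complex" where
  "corr_kernel a \<alpha> N r\<^sub>1 r\<^sub>2 = (\<lambda>(m, u) (m', u').
     kernel_block a \<alpha> N r\<^sub>1 r\<^sub>2 m ((u + 1) div 2) m' ((u' + 1) div 2) $ ix (u' mod 2) $ ix (u mod 2))"


section \<open>The elliptic curve and the flow\<close>

text \<open>The curve is the zero set of this function.\<close>

definition curve_fun :: "real \<Rightarrow> real \<Rightarrow> real \<Rightarrow> real \<Rightarrow> real" where
  "curve_fun a \<alpha> x y =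
     y\<^sup>2 - (x\<^sup>2 + 4 * x * (x - a\<^sup>2) * (x - 1 / a\<^sup>2) / ((a + 1 / a)\<^sup>2 * (\<alpha> + 1 / \<alpha>)\<^sup>2))"

text \<open>For a point \<open>(x, y)\<close> of the curve with \<open>x < 0\<close>, the line through it and \<open>(a\<^sup>-\<^sup>2, a\<^sup>-\<^sup>2)\<close> is the
  graph \<open>t \<mapsto> (t, l t)\<close>. On it, \<^const>\<open>curve_fun\<close> is a cubic polynomial in \<open>t\<close> with the roots
  \<open>a\<^sup>-\<^sup>2\<close> and \<open>x\<close>; the third intersection point, counted with multiplicity, is given by the remaining
  root \<open>x\<^sub>3\<close>. This includes \<open>\<alpha> = 1\<close>, where the curve is singular at its only point \<open>(-1, 0)\<close> with
  \<open>x < 0\<close>.\<close>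

definition flow :: "real \<Rightarrow> real \<Rightarrow> real \<times> real \<Rightarrow> real \<times> real" where
  "flow a \<alpha> = (\<lambda>(x, y).
     let q = 1 / a\<^sup>2;
         l = (\<lambda>t. q + (y - q) / (x - q) * (t - q));
         x\<^sub>3 = (THE x\<^sub>3. \<exists>c. c \<noteq> 0 \<and>
                 (\<forall>t. curve_fun a \<alpha> t (l t) = c * (t - q) * (t - x) * (t - x\<^sub>3)))
     in (x\<^sub>3, - l x\<^sub>3))"

definition start_pt :: "real \<Rightarrow> real \<times> real" where
  "start_pt \<alpha> = (- 1, - ((1 - \<alpha>\<^sup>2) / (1 + \<alpha>\<^sup>2)))"

definition orbit :: "real \<Rightarrow> real \<Rightarrow> nat \<Rightarrow> real \<times> real" where
  "orbit a \<alpha> j = (flow a \<alpha> ^^ j) (start_pt \<alpha>)"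

definition fun_a :: "real \<Rightarrow> real \<Rightarrow> real \<times> real \<Rightarrow> real" where
  "fun_a a \<alpha> = (\<lambda>(x, y). a * (a\<^sup>2 + 1) * (\<alpha>\<^sup>2 + 1) / 2 * ((y - x) / (1 - a\<^sup>2 * x)))"

definition fun_b :: "real \<Rightarrow> real \<Rightarrow> real \<times> real \<Rightarrow> real" where
  "fun_b a \<alpha> = (\<lambda>(x, y). - (1 / (\<alpha> * a * x)))"

definition fun_d :: "real \<Rightarrow> real \<Rightarrow> real \<times> real \<Rightarrow> real" where
  "fun_d a \<alpha> = (\<lambda>(x, y).
     2 * a * \<alpha> * x * (x - 1 / a\<^sup>2) / ((a\<^sup>2 + 1) * (\<alpha> + 1 / \<alpha>) * (y - x)))"

definition P_minus :: "real \<Rightarrow> real \<Rightarrow> nat \<Rightarrow> complex \<Rightarrow> cmat" where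
  "P_minus a \<alpha> N z = mprod (\<lambda>j.
     of_real (fun_b a \<alpha> (orbit a \<alpha> j)) *m
       (mat2 (of_real (fun_a a \<alpha> (orbit a \<alpha> j))) 0 0 1 **
        mat2 1 1 (of_real (a\<^sup>2) / z) 1 **
        mat2 1 0 0 (of_real (fun_a a \<alpha> (orbit a \<alpha> j))))) [0..<N]"

definition P_plus :: "real \<Rightarrow> real \<Rightarrow> nat \<Rightarrow> complex \<Rightarrow> cmat" where
  "P_plus a \<alpha> N z = mprod (\<lambda>j.
     mat2 1 0 0 (of_real (a\<^sup>2 / \<alpha>\<^sup>2 * fun_d a \<alpha> (orbit a \<alpha> (N - 1 - j)))) **
     mat2 1 (of_real (a\<^sup>2) * z) 1 1 **
     mat2 1 0 0 (of_real (fun_d a \<alpha> (orbit a \<alpha> (N - 1 - j))))) [0..<N]"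

end

theory Submission
  imports Defs
begin

text \<open>The kernel depends on the Wiener--Hopf factors of the symbol \<open>A\<close> only through the product
  \<open>A\<^sub>+(w)\<^sup>-\<^sup>1 A\<^sub>-(z)\<^sup>-\<^sup>1\<close>, which does not change when a constant invertible matrix is moved from one factor
  to the other. Since \<open>A\<^sub>o A\<^sub>e = P / (1 - a\<^sup>2/z)\<close>, the symbol is \<open>A = P\<^sup>N / (1 - a\<^sup>2/z)\<^sup>N\<close>, so the theorem
  amounts to the factorization \<open>P\<^sup>N = P\<^sub>- P\<^sub>+\<close>, to the position of the zeros of \<open>det P\<^sub>-\<close> and
  \<open>det P\<^sub>+\<close>, and to the uniqueness of Wiener--Hopf factorizations.

  Let \<open>M\<^sub>p\<close> and \<open>R\<^sub>p\<close> be the factors that a point \<open>p\<close> of the curve contributes to \<open>P\<^sub>-\<close> and \<open>P\<^sub>+\<close>. The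
  flow is made for exchanging them: \<open>R\<^sub>p M\<^sub>p = M\<^sub>q R\<^sub>q\<close> for \<open>q = \<sigma>(p)\<close>
  (\<open>plus_minus_step_flow\<close>). At the starting point \<open>M\<^sub>p R\<^sub>p = P\<close> (\<open>minus_plus_step_start\<close>), hence
  \<open>P\<^sup>N = M\<^sub>p (R\<^sub>p M\<^sub>p)\<^sup>N\<^sup>-\<^sup>1 R\<^sub>p = M\<^sub>p (M\<^sub>q R\<^sub>q)\<^sup>N\<^sup>-\<^sup>1 R\<^sub>p\<close>, and iterating this moves all left factors to the left
  (\<open>P_power_factorization\<close>). The exchange relation is a system of five equations between real numbers
  (\<open>flow_relations\<close>). They become transparent in the coordinate \<open>fun_a\<close> of the curve, which is an affine
  function of the slope of the line through \<open>(a\<^sup>-\<^sup>2, a\<^sup>-\<^sup>2)\<close>: in terms of \<open>x\<close> and this coordinate the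
  equation of the curve says that \<open>M\<^sub>p R\<^sub>p\<close> has the same trace as \<open>P\<close>, and the next point of the orbit is
  read off from the product of the roots of a cubic polynomial.

  The determinant of \<open>P\<^sub>-\<close> vanishes at most at \<open>a\<^sup>2\<close>, that of \<open>P\<^sub>+\<close> at most at \<open>a\<^sup>-\<^sup>2\<close>. So
  \<open>(1 - a\<^sup>2/z)\<^sup>-\<^sup>N P\<^sub>-(z) P\<^sub>-(\<infinity>)\<^sup>-\<^sup>1\<close> and \<open>P\<^sub>-(\<infinity>) P\<^sub>+(z)\<close> form a Wiener--Hopf factorization of \<open>A\<close>
  (\<open>wiener_hopf_W\<close>), and by Liouville's theorem there is no other one on the annulus
  (\<open>wiener_hopf_unique\<close>).
  What remains is to collect the transition matrices in pairs (\<open>mprod_A_step\<close>) and to check, with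
  Cauchy's theorem, that the radii of the two circles do not matter (\<open>double_circle_int_radii\<close>).\<close>

text \<open>The dollar sign denotes entries of vectors and matrices only, not coefficients of power series.\<close>

no_notation fps_nth (infixl "$" 75)

section \<open>Two-by-two matrices\<close>

lemma mat2_nth [simp]:
  "mat2 p q r s $ 1 $ 1 = p" "mat2 p q r s $ 1 $ 2 = q"
  "mat2 p q r s $ 2 $ 1 = r" "mat2 p q r s $ 2 $ 2 = s"
  by (simp_all add: mat2_def)

lemma mscale_nth [simp]: "(c *m M) $ i $ j = c * M $ i $ j"
  by (simp add: mscale_def)

lemma mat_1_nth [simp]:
  "(mat 1 :: cmat) $ 1 $ 1 = 1" "(mat 1 :: cmat) $ 1 $ 2 = 0"
  "(mat 1 :: cmat) $ 2 $ 1 = 0" "(mat 1 :: cmat) $ 2 $ 2 = 1"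
  by (simp_all add: mat_def)

lemma cmat_mult_nth: "((M :: cmat) ** M') $ i $ j = M $ i $ 1 * M' $ 1 $ j + M $ i $ 2 * M' $ 2 $ j"
  by (simp add: matrix_matrix_mult_def sum_2)

lemma cmat_eq_iff:
  "(M :: cmat) = M' \<longleftrightarrow> M $ 1 $ 1 = M' $ 1 $ 1 \<and> M $ 1 $ 2 = M' $ 1 $ 2 \<and>
     M $ 2 $ 1 = M' $ 2 $ 1 \<and> M $ 2 $ 2 = M' $ 2 $ 2"
  by (auto simp: vec_eq_iff forall_2)

lemma mscale_mult_left: "(c *m M) ** M' = c *m (M ** M')"
  by (simp add: cmat_eq_iff cmat_mult_nth algebra_simps)

lemma mscale_mult_right: "M ** (c *m M') = c *m (M ** M')"
  by (simp add: cmat_eq_iff cmat_mult_nth algebra_simps)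

lemma mscale_mscale: "c *m d *m M = (c * d) *m M"
  by (simp add: cmat_eq_iff)

lemma mscale_one [simp]: "1 *m M = M"
  by (simp add: cmat_eq_iff)

lemmas mscale_simps = mscale_mult_left mscale_mult_right mscale_mscale

lemma det_mscale [simp]: "det (c *m M) = c\<^sup>2 * det M"
  by (simp add: det_2 power2_eq_square algebra_simps)

lemma det_mat2 [simp]: "det (mat2 p q r s) = p * s - q * r"
  by (simp add: det_2)

subsection \<open>Inverses\<close>

lemma
  fixes M :: cmat
  assumes "det M \<noteq> 0"
  shows matrix_inv_mult: "matrix_inv M ** M = mat 1"
    and mult_matrix_inv: "M ** matrix_inv M = mat 1"
proof -
  have "\<exists>M'. M ** M' = mat 1 \<and> M' ** M = mat 1"
    using assms invertible_det_nz[of M] by (simp add: invertible_def)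
  then have "M ** matrix_inv M = mat 1 \<and> matrix_inv M ** M = mat 1"
    unfolding matrix_inv_def by (rule someI_ex)
  then show "matrix_inv M ** M = mat 1" "M ** matrix_inv M = mat 1"
    by auto
qed

lemma matrix_inv_eqI:
  fixes M :: cmat
  assumes "M ** M' = mat 1"
  shows "matrix_inv M = M'"
proof -
  have "det M * det M' = 1"
    using arg_cong[OF assms, of det] by (simp add: det_mul)
  then have "det M \<noteq> 0"
    by auto
  then have "matrix_inv M = matrix_inv M ** (M ** M')"
    by (simp add: assms)
  also have "\<dots> = M'"
    by (simp add: matrix_mul_assoc matrix_inv_mult \<open>det M \<noteq> 0\<close>)
  finally show ?thesis .
qed

text \<open>Holomorphy and limits pass to inverses through this formula.\<close>

lemma matrix_inv_cofactor:
  fixes M :: cmat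
  assumes "det M \<noteq> 0"
  shows "matrix_inv M = (1 / det M) *m mat2 (M $ 2 $ 2) (- M $ 1 $ 2) (- M $ 2 $ 1) (M $ 1 $ 1)"
  by (rule matrix_inv_eqI)
     (use assms in \<open>simp add: cmat_eq_iff cmat_mult_nth divide_simps, simp add: det_2 algebra_simps\<close>)

lemma matrix_inv_product:
  fixes M M' :: cmat
  assumes "det M \<noteq> 0" "det M' \<noteq> 0"
  shows "matrix_inv (M ** M') = matrix_inv M' ** matrix_inv M"
proof (rule matrix_inv_eqI)
  have "(M ** M') ** (matrix_inv M' ** matrix_inv M) = M ** (M' ** matrix_inv M') ** matrix_inv M"
    by (simp only: matrix_mul_assoc)
  then show "(M ** M') ** (matrix_inv M' ** matrix_inv M) = mat 1"
    by (simp add: mult_matrix_inv assms)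
qed

lemma matrix_inv_mscale:
  assumes "c \<noteq> 0" "det M \<noteq> 0"
  shows "matrix_inv (c *m M) = (1 / c) *m matrix_inv M"
  by (rule matrix_inv_eqI) (use assms in \<open>simp add: mscale_simps mult_matrix_inv\<close>)

subsection \<open>Ordered products and powers\<close>

lemma mprod_Nil [simp]: "mprod F [] = mat 1"
  and mprod_Cons [simp]: "mprod F (k # ks) = F k ** mprod F ks"
  by (simp_all add: mprod_def)

lemma mprod_append: "mprod F (ks @ ls) = mprod F ks ** mprod F ls"
  by (induction ks) (simp_all add: matrix_mul_assoc)

lemma mprod_map: "mprod F (map g ks) = mprod (\<lambda>k. F (g k)) ks"
  by (induction ks) simp_all

lemma mprod_cong:
  assumes "\<And>k. k \<in> set ks \<Longrightarrow> F k = F' k"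
  shows "mprod F ks = mprod F' ks"
  using assms by (induction ks) simp_all

lemma det_mprod_nonzero:
  assumes "\<And>k. k \<in> set ks \<Longrightarrow> det (F k) \<noteq> 0"
  shows "det (mprod F ks) \<noteq> 0"
  using assms by (induction ks) (simp_all add: det_mul)

definition mpow :: "cmat \<Rightarrow> nat \<Rightarrow> cmat" where
  "mpow M n = ((**) M ^^ n) (mat 1)"

lemma mpow_0 [simp]: "mpow M 0 = mat 1"
  and mpow_Suc: "mpow M (Suc n) = M ** mpow M n"
  by (simp_all add: mpow_def)

lemma mpow_mscale: "mpow (c *m M) n = (c ^ n) *m mpow M n"
  by (induction n) (simp_all add: mpow_Suc mscale_simps mult.commute)

text \<open>Regrouping \<open>(M M') (M M') \<dots> (M M')\<close> around the first and the last factor.\<close>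

lemma mpow_conjugate: "mpow (M ** M') (Suc n) = M ** mpow (M' ** M) n ** M'"
proof (induction n)
  case (Suc n)
  have "mpow (M ** M') (Suc (Suc n)) = M ** M' ** mpow (M ** M') (Suc n)"
    by (rule mpow_Suc)
  also have "\<dots> = M ** (M' ** M ** mpow (M' ** M) n) ** M'"
    by (simp only: Suc.IH matrix_mul_assoc)
  finally show ?case
    by (simp only: mpow_Suc)
qed (simp add: mpow_Suc)

text \<open>If \<open>R\<^sub>j M\<^sub>j = M\<^sub>j\<^sub>+\<^sub>1 R\<^sub>j\<^sub>+\<^sub>1\<close>, then \<open>(M\<^sub>0 R\<^sub>0)\<^sup>n\<^sup>+\<^sup>1 = M\<^sub>0 (R\<^sub>0 M\<^sub>0)\<^sup>n R\<^sub>0 = M\<^sub>0 (M\<^sub>1 R\<^sub>1)\<^sup>n R\<^sub>0\<close>, and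
  the induction hypothesis applies to the shifted sequences.\<close>

lemma mpow_exchange:
  assumes "\<And>j. R j ** M j = M (Suc j) ** R (Suc j)"
  shows "mpow (M 0 ** R 0) n = mprod M [0..<n] ** mprod (\<lambda>j. R (n - 1 - j)) [0..<n]"
  using assms
proof (induction n arbitrary: M R)
  case (Suc n)
  have M: "mprod M [0..<Suc n] = M 0 ** mprod (\<lambda>j. M (Suc j)) [0..<n]"
    by (simp add: upt_conv_Cons mprod_map[symmetric] map_Suc_upt del: upt_Suc)
  have "mprod (\<lambda>j. R (Suc n - 1 - j)) [0..<Suc n] = mprod (\<lambda>j. R (n - j)) [0..<n] ** R 0"
    by (simp add: mprod_append)
  also have "mprod (\<lambda>j. R (n - j)) [0..<n] = mprod (\<lambda>j. R (Suc (n - 1 - j))) [0..<n]"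
    by (rule mprod_cong) (simp add: Suc_diff_Suc)
  finally have R: "mprod (\<lambda>j. R (Suc n - 1 - j)) [0..<Suc n] =
      mprod (\<lambda>j. R (Suc (n - 1 - j))) [0..<n] ** R 0" .
  show ?case
    using Suc.IH[of "\<lambda>j. R (Suc j)" "\<lambda>j. M (Suc j)"] Suc.prems
    unfolding mpow_conjugate M R by (simp add: matrix_mul_assoc)
qed simp

lemma mpowi_nonneg: "0 \<le> k \<Longrightarrow> mpowi M k = mpow M (nat k)"
  by (simp add: mpowi_def mpow_def)

lemma mpowi_0 [simp]: "mpowi M 0 = mat 1"
  and mpowi_1 [simp]: "mpowi M 1 = M"
  and mpowi_minus_1 [simp]: "mpowi M (- 1) = matrix_inv M"
  by (simp_all add: mpowi_def)

section \<open>Holomorphic matrix functions\<close>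

lemma mat_holomorphic_onI:
  assumes "(\<lambda>z. F z $ 1 $ 1) holomorphic_on S" "(\<lambda>z. F z $ 1 $ 2) holomorphic_on S"
    "(\<lambda>z. F z $ 2 $ 1) holomorphic_on S" "(\<lambda>z. F z $ 2 $ 2) holomorphic_on S"
  shows "mat_holomorphic_on F S"
  using assms by (simp add: mat_holomorphic_on_def forall_2)

lemma mat_holomorphic_on_nth [holomorphic_intros]:
  "mat_holomorphic_on F S \<Longrightarrow> (\<lambda>z. F z $ i $ j) holomorphic_on S"
  by (simp add: mat_holomorphic_on_def)

lemma mat_holomorphic_on_const: "mat_holomorphic_on (\<lambda>z. M) S"
  by (simp add: mat_holomorphic_on_def)

lemma mat_holomorphic_on_mult:
  assumes "mat_holomorphic_on F S" "mat_holomorphic_on G S"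
  shows "mat_holomorphic_on (\<lambda>z. F z ** G z) S"
  unfolding mat_holomorphic_on_def cmat_mult_nth
  by (intro allI holomorphic_intros assms)

lemma mat_holomorphic_on_mscale:
  assumes "f holomorphic_on S" "mat_holomorphic_on F S"
  shows "mat_holomorphic_on (\<lambda>z. f z *m F z) S"
  unfolding mat_holomorphic_on_def mscale_nth
  by (intro allI holomorphic_intros assms)

lemma mat_holomorphic_on_mprod:
  assumes "\<And>k. k \<in> set ks \<Longrightarrow> mat_holomorphic_on (F k) S"
  shows "mat_holomorphic_on (\<lambda>z. mprod (\<lambda>k. F k z) ks) S"
  using assms
  by (induction ks) (simp_all add: mat_holomorphic_on_const mat_holomorphic_on_mult)

lemma mat_holomorphic_on_cong:
  assumes "mat_holomorphic_on F S" "\<And>z. z \<in> S \<Longrightarrow> F z = G z"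
  shows "mat_holomorphic_on G S"
  unfolding mat_holomorphic_on_def
proof (intro allI)
  fix i j
  show "(\<lambda>z. G z $ i $ j) holomorphic_on S"
    using mat_holomorphic_on_nth[OF assms(1), of i j] by (rule holomorphic_transform) (simp add: assms)
qed

lemma mat_holomorphic_on_matrix_inv:
  assumes "mat_holomorphic_on F S" "\<And>z. z \<in> S \<Longrightarrow> det (F z) \<noteq> 0"
  shows "mat_holomorphic_on (\<lambda>z. matrix_inv (F z)) S"
proof (rule mat_holomorphic_on_cong)
  show "mat_holomorphic_on (\<lambda>z. (1 / det (F z)) *m
      mat2 (F z $ 2 $ 2) (- F z $ 1 $ 2) (- F z $ 2 $ 1) (F z $ 1 $ 1)) S"
    using assms(2) unfolding det_2
    by (intro mat_holomorphic_on_mscale mat_holomorphic_onI)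
       (auto simp: intro!: holomorphic_intros assms(1))
qed (simp add: matrix_inv_cofactor assms)

lemma mat_holomorphic_on_subset:
  "mat_holomorphic_on F S \<Longrightarrow> T \<subseteq> S \<Longrightarrow> mat_holomorphic_on F T"
  by (auto simp: mat_holomorphic_on_def intro: holomorphic_on_subset)

lemma mat_holomorphic_on_Un:
  "mat_holomorphic_on F S \<Longrightarrow> mat_holomorphic_on F T \<Longrightarrow> open S \<Longrightarrow> open T \<Longrightarrow>
    mat_holomorphic_on F (S \<union> T)"
  by (auto simp: mat_holomorphic_on_def intro: holomorphic_on_Un)

lemma cmat_continuous_onI:
  fixes F :: "'a :: topological_space \<Rightarrow> cmat"
  assumes "\<And>i j. continuous_on S (\<lambda>z. F z $ i $ j)"
  shows "continuous_on S F"
proof -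
  have "continuous_on S (\<lambda>z. \<chi> i j. F z $ i $ j)"
    by (intro continuous_on_vec_lambda assms)
  then show ?thesis
    by (simp add: vec_lambda_eta)
qed

lemma mat_holomorphic_on_imp_continuous_on:
  "mat_holomorphic_on F S \<Longrightarrow> continuous_on S F"
  by (auto simp: mat_holomorphic_on_def intro!: cmat_continuous_onI holomorphic_on_imp_continuous_on)

lemma tendsto_cmat_mult:
  fixes F G :: "'a \<Rightarrow> cmat"
  assumes "(F \<longlongrightarrow> M) \<A>" "(G \<longlongrightarrow> M') \<A>"
  shows "((\<lambda>z. F z ** G z) \<longlongrightarrow> M ** M') \<A>"
proof (intro vec_tendstoI)
  show "((\<lambda>z. (F z ** G z) $ i $ j) \<longlongrightarrow> (M ** M') $ i $ j) \<A>" for i j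
    unfolding cmat_mult_nth by (intro tendsto_intros assms)
qed

lemma tendsto_mprod:
  assumes "\<And>k. k \<in> set ks \<Longrightarrow> (F k \<longlongrightarrow> M k) \<A>"
  shows "((\<lambda>z. mprod (\<lambda>k. F k z) ks) \<longlongrightarrow> mprod M ks) \<A>"
  using assms by (induction ks) (simp_all add: tendsto_cmat_mult)

lemma tendsto_cmatI:
  fixes F :: "'a \<Rightarrow> cmat"
  assumes "((\<lambda>z. F z $ 1 $ 1) \<longlongrightarrow> M $ 1 $ 1) \<A>" "((\<lambda>z. F z $ 1 $ 2) \<longlongrightarrow> M $ 1 $ 2) \<A>"
    "((\<lambda>z. F z $ 2 $ 1) \<longlongrightarrow> M $ 2 $ 1) \<A>" "((\<lambda>z. F z $ 2 $ 2) \<longlongrightarrow> M $ 2 $ 2) \<A>"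
  shows "(F \<longlongrightarrow> M) \<A>"
proof (intro vec_tendstoI)
  show "((\<lambda>z. F z $ i $ j) \<longlongrightarrow> M $ i $ j) \<A>" for i j :: 2
    using assms exhaust_2[of i] exhaust_2[of j] by auto
qed

lemma tendsto_matrix_inv:
  fixes F :: "'a \<Rightarrow> cmat"
  assumes "(F \<longlongrightarrow> M) \<A>" "det M \<noteq> 0"
  shows "((\<lambda>z. matrix_inv (F z)) \<longlongrightarrow> matrix_inv M) \<A>"
proof (rule Lim_transform_eventually)
  note entry = tendsto_vec_nth[OF tendsto_vec_nth[OF assms(1)]]
  have det: "((\<lambda>z. det (F z)) \<longlongrightarrow> det M) \<A>"
    unfolding det_2 by (intro tendsto_intros entry)
  show "((\<lambda>z. (1 / det (F z)) *m mat2 (F z $ 2 $ 2) (- F z $ 1 $ 2) (- F z $ 2 $ 1) (F z $ 1 $ 1)) \<longlongrightarrow>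
      matrix_inv M) \<A>"
    unfolding matrix_inv_cofactor[OF assms(2)]
    by (intro tendsto_cmatI; simp only: mscale_nth mat2_nth)
       (intro tendsto_mult tendsto_divide tendsto_const tendsto_minus det entry assms(2))+
  show "\<forall>\<^sub>F z in \<A>. (1 / det (F z)) *m
      mat2 (F z $ 2 $ 2) (- F z $ 1 $ 2) (- F z $ 2 $ 1) (F z $ 1 $ 1) = matrix_inv (F z)"
    using tendsto_imp_eventually_ne[OF det assms(2)]
    by eventually_elim (simp add: matrix_inv_cofactor)
qed

lemma mat_holomorphic_on_If_Un:
  assumes "mat_holomorphic_on F S" "mat_holomorphic_on G T" "open S" "open T"
    "\<And>z. z \<in> S \<Longrightarrow> z \<in> T \<Longrightarrow> F z = G z"
  shows "mat_holomorphic_on (\<lambda>z. if z \<in> S then F z else G z) (S \<union> T)"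
  unfolding mat_holomorphic_on_def
proof (intro allI)
  fix i j
  have "(\<lambda>z. if z \<in> S then F z $ i $ j else G z $ i $ j) holomorphic_on (S \<union> T)"
    using assms by (intro holomorphic_on_If_Un mat_holomorphic_on_nth) auto
  then show "(\<lambda>z. (if z \<in> S then F z else G z) $ i $ j) holomorphic_on (S \<union> T)"
    by (simp add: if_distrib[of "\<lambda>M. M $ i $ j"])
qed

lemma mat_Liouville:
  assumes "mat_holomorphic_on F UNIV" "(F \<longlongrightarrow> M) at_infinity"
  shows "F z = M"
proof -
  have "F z $ i $ j = M $ i $ j" for i j
    by (rule Liouville_weak[where f = "\<lambda>z. F z $ i $ j"])
       (intro mat_holomorphic_on_nth tendsto_vec_nth assms)+
  then show ?thesis
    by (simp add: vec_eq_iff)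
qed

section \<open>The elliptic flow and the exchange of factors\<close>

text \<open>With this constant \<open>\<kappa>\<close>, the curve is \<open>y\<^sup>2 = x\<^sup>2 + x (x - a\<^sup>2) (x - a\<^sup>-\<^sup>2) / \<kappa>\<^sup>2\<close>, and \<open>2 a \<kappa>\<close> is the
  trace of \<open>P\<close>.\<close>

definition curve_const :: "real \<Rightarrow> real \<Rightarrow> real" where
  "curve_const a \<alpha> = (a + 1 / a) * (\<alpha> + 1 / \<alpha>) / 2"

text \<open>The factors that a single point of the orbit contributes to \<open>P\<^sub>-\<close> and \<open>P\<^sub>+\<close>.\<close>

definition minus_step :: "real \<Rightarrow> real \<Rightarrow> real \<times> real \<Rightarrow> complex \<Rightarrow> cmat" where
  "minus_step a \<alpha> p z = of_real (fun_b a \<alpha> p) *m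
     (mat2 (of_real (fun_a a \<alpha> p)) 0 0 1 ** mat2 1 1 (of_real (a\<^sup>2) / z) 1 **
      mat2 1 0 0 (of_real (fun_a a \<alpha> p)))"

definition plus_step :: "real \<Rightarrow> real \<Rightarrow> real \<times> real \<Rightarrow> complex \<Rightarrow> cmat" where
  "plus_step a \<alpha> p z =
     mat2 1 0 0 (of_real (a\<^sup>2 / \<alpha>\<^sup>2 * fun_d a \<alpha> p)) ** mat2 1 (of_real (a\<^sup>2) * z) 1 1 **
     mat2 1 0 0 (of_real (fun_d a \<alpha> p))"

text \<open>The third root is determined even if it coincides with \<open>q\<close> or \<open>x\<close>: away from these two points the
  common factors cancel, and two affine functions are left that agree at infinitely many points.\<close>

lemma cubic_third_root_unique:
  fixes c c' q x u v :: real
  assumes "c' \<noteq> 0" "\<And>t. c * (t - q) * (t - x) * (t - u) = c' * (t - q) * (t - x) * (t - v)"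
  shows "u = v"
proof -
  define s where "s = max q x"
  have eq: "c * (t - u) = c' * (t - v)" if "s < t" for t
    using assms(2)[of t] that by (auto simp: s_def)
  have "c * (s + 1 - u) = c' * (s + 1 - v)" "c * (s + 2 - u) = c' * (s + 2 - v)"
    by (rule eq, simp)+
  then have "c = c'"
    by algebra
  with eq[of "s + 1"] assms(1) show ?thesis
    by simp
qed

context
  fixes a \<alpha> :: real
  assumes a_pos: "0 < a" and alpha_pos: "0 < \<alpha>"
begin

abbreviation \<kappa> where "\<kappa> \<equiv> curve_const a \<alpha>"

lemma curve_const_pos: "0 < \<kappa>"
  using a_pos alpha_pos by (simp add: curve_const_def add_pos_pos)

lemma curve_fun_eq:
  "curve_fun a \<alpha> x y = y\<^sup>2 - x\<^sup>2 - x * (x - a\<^sup>2) * (x - 1 / a\<^sup>2) / \<kappa>\<^sup>2"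
proof -
  have "(a + 1 / a)\<^sup>2 * (\<alpha> + 1 / \<alpha>)\<^sup>2 = 4 * \<kappa>\<^sup>2"
    unfolding curve_const_def by (simp add: power_mult_distrib power_divide)
  then show ?thesis
    unfolding curve_fun_def by simp
qed

lemma fun_a_eq: "fun_a a \<alpha> (x, y) = a\<^sup>2 * \<alpha> * \<kappa> * (y - x) / (1 - a\<^sup>2 * x)"
proof -
  have "a * (a\<^sup>2 + 1) * (\<alpha>\<^sup>2 + 1) / 2 = a\<^sup>2 * \<alpha> * \<kappa>"
    unfolding curve_const_def using a_pos alpha_pos
    by (simp add: field_simps power2_eq_square)
  then show ?thesis
    unfolding fun_a_def by simp
qed

lemma one_minus_pos: "x < 0 \<Longrightarrow> 0 < 1 - a\<^sup>2 * x"
  by (smt (verit) mult_nonneg_nonpos zero_le_power2)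

text \<open>The line through \<open>(x, y)\<close> and \<open>(a\<^sup>-\<^sup>2, a\<^sup>-\<^sup>2)\<close> has the slope \<open>1 - A / (\<alpha> \<kappa>)\<close> with \<open>A = fun_a a \<alpha> (x, y)\<close>, so
  \<open>A\<close> parametrizes the pencil of lines in the definition of the flow.\<close>

lemma ordinate_eq:
  assumes "x < 0"
  shows "y = x - fun_a a \<alpha> (x, y) / (\<alpha> * \<kappa>) * (x - 1 / a\<^sup>2)"
  using one_minus_pos[OF assms] curve_const_pos a_pos alpha_pos
  unfolding fun_a_eq by (simp add: divide_simps) (simp add: algebra_simps)

text \<open>The equation of the curve in the coordinates \<open>x\<close> and \<open>A\<close>. All lines of the pencil pass through the point
  \<open>(a\<^sup>-\<^sup>2, a\<^sup>-\<^sup>2)\<close> of the curve, which is why the factor \<open>1 - a\<^sup>2 x\<close> splits off.\<close>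

lemma curve_imp_quadratic:
  assumes "x < 0" "curve_fun a \<alpha> x y = 0" 
  defines "A \<equiv> fun_a a \<alpha> (x, y)"
  shows "A\<^sup>2 * (1 - a\<^sup>2 * x) + 2 * a\<^sup>2 * \<alpha> * \<kappa> * x * A + a\<^sup>2 * \<alpha>\<^sup>2 * x * (x - a\<^sup>2) = 0"
proof -
  have y: "y = x + A * (1 - a\<^sup>2 * x) / (a\<^sup>2 * \<alpha> * \<kappa>)"
    using one_minus_pos[OF assms(1)] curve_const_pos a_pos alpha_pos
    unfolding A_def fun_a_eq by (simp add: divide_simps)
  have "(1 - a\<^sup>2 * x) *
      (A\<^sup>2 * (1 - a\<^sup>2 * x) + 2 * a\<^sup>2 * \<alpha> * \<kappa> * x * A + a\<^sup>2 * \<alpha>\<^sup>2 * x * (x - a\<^sup>2)) =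
      (a\<^sup>2 * \<alpha> * \<kappa>)\<^sup>2 * curve_fun a \<alpha> x y"
    using curve_const_pos a_pos alpha_pos unfolding curve_fun_eq y
    by (simp add: divide_simps power2_eq_square) (simp add: algebra_simps)
  then show ?thesis
    using one_minus_pos[OF assms(1)] assms(2) by simp
qed

text \<open>For \<open>x < 0\<close> the cubic term of the curve is a product of three negative factors, so \<open>y\<^sup>2 < x\<^sup>2\<close>.\<close>

lemma curve_above_diagonal:
  assumes "x < 0" "curve_fun a \<alpha> x y = 0"
  shows "x < y"
proof -
  have "x - a\<^sup>2 < 0" "x - 1 / a\<^sup>2 < 0"
    using assms(1) a_pos by (smt (verit) zero_less_power zero_less_divide_1_iff)+
  then have "x * (x - a\<^sup>2) * (x - 1 / a\<^sup>2) / \<kappa>\<^sup>2 < 0"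
    using assms(1) curve_const_pos
    by (intro divide_neg_pos mult_pos_neg mult_neg_neg) auto
  then have "y\<^sup>2 < x\<^sup>2"
    using assms(2) unfolding curve_fun_eq by linarith
  then have "\<bar>y\<bar> < \<bar>x\<bar>"
    by (metis not_le abs_le_square_iff)
  then show ?thesis
    using assms(1) by linarith
qed

lemma fun_a_pos:
  assumes "x < 0" "curve_fun a \<alpha> x y = 0"
  shows "0 < fun_a a \<alpha> (x, y)"
  unfolding fun_a_eq
  using curve_above_diagonal[OF assms] one_minus_pos[OF assms(1)] curve_const_pos a_pos alpha_pos
  by simp

lemma fun_a_times_fun_d:
  assumes "x < 0" "curve_fun a \<alpha> x y = 0"
  shows "fun_a a \<alpha> (x, y) * fun_d a \<alpha> (x, y) = - \<alpha>\<^sup>2 * x"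
proof -
  have "(a\<^sup>2 + 1) * (\<alpha> + 1 / \<alpha>) = 2 * a * \<kappa>"
    unfolding curve_const_def using a_pos alpha_pos by (simp add: field_simps power2_eq_square)
  then have d: "fun_d a \<alpha> (x, y) = 2 * a * \<alpha> * x * (x - 1 / a\<^sup>2) / (2 * a * \<kappa> * (y - x))"
    unfolding fun_d_def by simp
  show ?thesis
    using curve_above_diagonal[OF assms] one_minus_pos[OF assms(1)] curve_const_pos a_pos alpha_pos
    unfolding fun_a_eq d
    by (simp add: divide_simps) (simp add: algebra_simps power2_eq_square)
qed

text \<open>Two of the three roots on the line are \<open>a\<^sup>-\<^sup>2\<close> and \<open>x\<close>. The remaining quadratic factor has the product of
  roots \<open>A\<^sup>2 / (a\<^sup>2 \<alpha>\<^sup>2)\<close>, which gives the third one; that the sum of roots fits as well is the quadratic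
  relation between \<open>x\<close> and \<open>A\<close>.\<close>

lemma curve_fun_on_line:
  assumes "x < 0" "curve_fun a \<alpha> x y = 0"
  defines "A \<equiv> fun_a a \<alpha> (x, y)"
  shows "curve_fun a \<alpha> t (t - A / (\<alpha> * \<kappa>) * (t - 1 / a\<^sup>2)) =
    - (1 / \<kappa>\<^sup>2) * (t - 1 / a\<^sup>2) * (t - x) * (t - A\<^sup>2 / (a\<^sup>2 * \<alpha>\<^sup>2 * x))"
proof -
  define x' where "x' = A\<^sup>2 / (a\<^sup>2 * \<alpha>\<^sup>2 * x)"
  define g where "g = A / \<alpha>"
  have quad: "A\<^sup>2 * (1 - a\<^sup>2 * x) + 2 * a\<^sup>2 * \<alpha> * \<kappa> * x * A + a\<^sup>2 * \<alpha>\<^sup>2 * x * (x - a\<^sup>2) = 0"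
    using curve_imp_quadratic[OF assms(1,2)] unfolding A_def .
  have A: "A = g * \<alpha>"
    using alpha_pos by (simp add: g_def)
  have "x * x' = g\<^sup>2 / a\<^sup>2"
    using assms(1) by (simp add: x'_def g_def power_divide)
  moreover have "x + x' = g\<^sup>2 - 2 * \<kappa> * g + a\<^sup>2"
  proof -
    have "(a\<^sup>2 * \<alpha>\<^sup>2 * x) * (x + x') = (a\<^sup>2 * \<alpha>\<^sup>2 * x) * (g\<^sup>2 - 2 * \<kappa> * g + a\<^sup>2)"
    proof -
      have "(a\<^sup>2 * \<alpha>\<^sup>2 * x) * x' = A\<^sup>2"
        using a_pos alpha_pos assms(1) by (simp add: x'_def)
      then show ?thesis
        using quad unfolding A by algebra
    qed
    then show ?thesis
      using a_pos alpha_pos assms(1) by simp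
  qed
  ultimately have "(t - x) * (t - x') = t\<^sup>2 - (g\<^sup>2 - 2 * \<kappa> * g + a\<^sup>2) * t + g\<^sup>2 / a\<^sup>2"
    by algebra
  moreover have "curve_fun a \<alpha> t (t - g / \<kappa> * (t - 1 / a\<^sup>2)) =
      - (1 / \<kappa>\<^sup>2) * (t - 1 / a\<^sup>2) * (t\<^sup>2 - (g\<^sup>2 - 2 * \<kappa> * g + a\<^sup>2) * t + g\<^sup>2 / a\<^sup>2)"
    using curve_const_pos a_pos unfolding curve_fun_eq
    by (simp add: divide_simps power2_eq_square) (simp add: algebra_simps)
  ultimately show ?thesis
    by (simp add: g_def x'_def mult.assoc)
qed

lemma flow_eq:
  assumes "x < 0" "curve_fun a \<alpha> x y = 0"
  defines "A \<equiv> fun_a a \<alpha> (x, y)"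
  defines "x' \<equiv> A\<^sup>2 / (a\<^sup>2 * \<alpha>\<^sup>2 * x)"
  shows "flow a \<alpha> (x, y) = (x', - (x' - A / (\<alpha> * \<kappa>) * (x' - 1 / a\<^sup>2)))"
proof -
  define q where "q = 1 / a\<^sup>2"
  define l where "l = (\<lambda>t. q + (y - q) / (x - q) * (t - q))"
  have "0 < q"
    using a_pos by (simp add: q_def)
  then have "x - q \<noteq> 0"
    using assms(1) by simp
  have "y - q = (1 - A / (\<alpha> * \<kappa>)) * (x - q)"
    using ordinate_eq[OF assms(1), of y] unfolding A_def[symmetric] q_def by algebra
  then have slope: "(y - q) / (x - q) = 1 - A / (\<alpha> * \<kappa>)"
    using \<open>x - q \<noteq> 0\<close> by simp
  have l: "l t = t - A / (\<alpha> * \<kappa>) * (t - q)" for t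
    unfolding l_def slope by (simp add: algebra_simps)
  have cubic: "curve_fun a \<alpha> t (l t) = - (1 / \<kappa>\<^sup>2) * (t - q) * (t - x) * (t - x')" for t
    unfolding l x'_def A_def q_def by (rule curve_fun_on_line[OF assms(1,2)])
  have nz: "- (1 / \<kappa>\<^sup>2) \<noteq> 0"
    using curve_const_pos by simp
  have "(THE x\<^sub>3. \<exists>c. c \<noteq> 0 \<and>
      (\<forall>t. curve_fun a \<alpha> t (l t) = c * (t - q) * (t - x) * (t - x\<^sub>3))) = x'"
  proof (rule the_equality)
    show "\<exists>c. c \<noteq> 0 \<and> (\<forall>t. curve_fun a \<alpha> t (l t) = c * (t - q) * (t - x) * (t - x'))"
      using cubic nz by blast
  next
    fix x\<^sub>3
    assume "\<exists>c. c \<noteq> 0 \<and> (\<forall>t. curve_fun a \<alpha> t (l t) = c * (t - q) * (t - x) * (t - x\<^sub>3))"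
    then obtain c where "\<And>t. curve_fun a \<alpha> t (l t) = c * (t - q) * (t - x) * (t - x\<^sub>3)"
      by blast
    then show "x\<^sub>3 = x'"
      using cubic_third_root_unique[OF nz, of c q x x\<^sub>3 x'] cubic by simp
  qed
  moreover have "flow a \<alpha> (x, y) = (let x\<^sub>3 = (THE x\<^sub>3. \<exists>c. c \<noteq> 0 \<and>
      (\<forall>t. curve_fun a \<alpha> t (l t) = c * (t - q) * (t - x) * (t - x\<^sub>3))) in (x\<^sub>3, - l x\<^sub>3))"
    unfolding flow_def prod.case Let_def q_def l_def ..
  ultimately have "flow a \<alpha> (x, y) = (x', - l x')"
    by (simp add: Let_def)
  then show ?thesis
    by (simp add: l q_def)
qed

definition on_curve :: "real \<times> real \<Rightarrow> bool" where
  "on_curve p \<longleftrightarrow> fst p < 0 \<and> curve_fun a \<alpha> (fst p) (snd p) = 0"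

text \<open>The new point is the reflection of an intersection point of line and curve. Its abscissa stays negative
  because the product of the old and the new one is \<open>A\<^sup>2 / (a\<^sup>2 \<alpha>\<^sup>2) > 0\<close>.\<close>

lemma on_curve_flow:
  assumes "on_curve p"
  shows "on_curve (flow a \<alpha> p)"
proof -
  obtain x y where p: "p = (x, y)" and x: "x < 0" and curve: "curve_fun a \<alpha> x y = 0"
    using assms by (cases p) (auto simp: on_curve_def)
  define A where "A = fun_a a \<alpha> (x, y)"
  define x' where "x' = A\<^sup>2 / (a\<^sup>2 * \<alpha>\<^sup>2 * x)"
  have "0 < A"
    unfolding A_def by (rule fun_a_pos[OF x curve])
  then have "x' < 0"
    using x a_pos alpha_pos unfolding x'_def by (intro divide_pos_neg mult_pos_neg) auto
  moreover have "curve_fun a \<alpha> x' (x' - A / (\<alpha> * \<kappa>) * (x' - 1 / a\<^sup>2)) = 0"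
    unfolding x'_def A_def by (simp only: curve_fun_on_line[OF x curve]) simp
  then have "curve_fun a \<alpha> x' (- (x' - A / (\<alpha> * \<kappa>) * (x' - 1 / a\<^sup>2))) = 0"
    unfolding curve_fun_def power2_minus .
  ultimately show ?thesis
    unfolding p flow_eq[OF x curve, folded A_def, folded x'_def] on_curve_def by simp
qed

lemma on_curve_start: "on_curve (start_pt \<alpha>)"
proof -
  have "(a + 1 / a)\<^sup>2 = (1 + a\<^sup>2) * (1 + 1 / a\<^sup>2)"
    using a_pos by (simp add: field_simps power2_eq_square)
  moreover have "1 + a\<^sup>2 \<noteq> 0"
    by (smt (verit) zero_le_power2)
  ultimately have *: "curve_fun a \<alpha> (- 1) y = y\<^sup>2 - 1 + 4 / (\<alpha> + 1 / \<alpha>)\<^sup>2" for y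
    using a_pos alpha_pos unfolding curve_fun_def
    by (simp add: divide_simps add_pos_pos) (simp add: algebra_simps)
  have "1 + \<alpha>\<^sup>2 > 0" by (simp add: add_pos_nonneg)
  have "\<alpha> + 1 / \<alpha> = (1 + \<alpha>\<^sup>2) / \<alpha>"
    using alpha_pos by (simp add: field_simps power2_eq_square)
  then have "((1 - \<alpha>\<^sup>2) / (1 + \<alpha>\<^sup>2))\<^sup>2 - 1 + 4 / (\<alpha> + 1 / \<alpha>)\<^sup>2 = 0"
    using alpha_pos \<open>1 + \<alpha>\<^sup>2 > 0\<close> by (simp add: power_divide divide_simps) (simp add: power2_eq_square algebra_simps)
  then show ?thesis
    unfolding on_curve_def start_pt_def by (simp add: *)
qed

lemma on_curve_orbit: "on_curve (orbit a \<alpha> j)"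
  unfolding orbit_def by (induction j) (simp_all add: on_curve_start on_curve_flow)

text \<open>The left-hand side is the trace of \<open>R\<^sub>p M\<^sub>p\<close>. Multiplied by \<open>\<alpha> a x A\<close>, the claim is the quadratic relation
  between \<open>x\<close> and \<open>A\<close>.\<close>

lemma factor_trace:
  assumes "on_curve p"
  defines "A \<equiv> fun_a a \<alpha> p" and "B \<equiv> fun_b a \<alpha> p" and "D \<equiv> fun_d a \<alpha> p"
  shows "B * (A + a ^ 4 * D) + a\<^sup>2 / \<alpha>\<^sup>2 * (B * A * D) * (A + D) = 2 * a * \<kappa>"
proof -
  obtain x y where p: "p = (x, y)" and x: "x < 0" and curve: "curve_fun a \<alpha> x y = 0"
    using assms by (cases p) (auto simp: on_curve_def)
  have "A > 0"
    unfolding A_def p by (rule fun_a_pos[OF x curve])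
  have quad: "A\<^sup>2 * (1 - a\<^sup>2 * x) + 2 * a\<^sup>2 * \<alpha> * \<kappa> * x * A + a\<^sup>2 * \<alpha>\<^sup>2 * x * (x - a\<^sup>2) = 0"
    using curve_imp_quadratic[OF x curve] unfolding A_def p .
  have AD: "A * D = - \<alpha>\<^sup>2 * x"
    unfolding A_def D_def p by (rule fun_a_times_fun_d[OF x curve])
  have D: "D = - \<alpha>\<^sup>2 * x / A"
    using AD \<open>A > 0\<close> by (simp add: field_simps)
  have B: "B = - 1 / (\<alpha> * a * x)"
    by (simp add: B_def fun_b_def p)
  have "\<alpha> * a * x * A * (B * (A + a ^ 4 * D) + a\<^sup>2 / \<alpha>\<^sup>2 * (B * A * D) * (A + D)) =
      \<alpha> * a * x * A * (2 * a * \<kappa>) - (A\<^sup>2 * (1 - a\<^sup>2 * x) + 2 * a\<^sup>2 * \<alpha> * \<kappa> * x * A + a\<^sup>2 * \<alpha>\<^sup>2 * x * (x - a\<^sup>2))"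
    unfolding B D using \<open>A > 0\<close> x a_pos alpha_pos
    by (simp add: field_simps power2_eq_square power4_eq_xxxx)
  then show ?thesis
    unfolding quad using \<open>A > 0\<close> x a_pos alpha_pos by simp
qed

text \<open>These are the equations between the coefficients of the entries of \<open>R\<^sub>p M\<^sub>p\<close> and \<open>M\<^sub>q R\<^sub>q\<close>, where \<open>q\<close> is the
  next point. By \<open>A D = - \<alpha>\<^sup>2 x\<close> the product \<open>B A D\<close> is the constant \<open>\<alpha> / a\<close>, and the second and the third
  equation both say that \<open>x x' = A\<^sup>2 / (a\<^sup>2 \<alpha>\<^sup>2)\<close>. The fourth one is a computation with the new ordinate, and the
  fifth one is the fourth one combined with the equality of the traces.\<close>

lemma flow_relations:
  assumes "on_curve p"
  defines "A \<equiv> fun_a a \<alpha> p" and "B \<equiv> fun_b a \<alpha> p" and "D \<equiv> fun_d a \<alpha> p"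
  defines "A' \<equiv> fun_a a \<alpha> (flow a \<alpha> p)" and "B' \<equiv> fun_b a \<alpha> (flow a \<alpha> p)"
    and "D' \<equiv> fun_d a \<alpha> (flow a \<alpha> p)"
  shows "B' * A' * D' = B * A * D"
    and "a\<^sup>2 / \<alpha>\<^sup>2 * B' * (A' * D')\<^sup>2 = B * A\<^sup>2"
    and "B' = a\<^sup>2 / \<alpha>\<^sup>2 * B * D\<^sup>2"
    and "B' * A' * (1 + a\<^sup>2 / \<alpha>\<^sup>2 * A' * D') = B * (A + a ^ 4 * D)"
    and "B' * D' * (a ^ 4 + a\<^sup>2 / \<alpha>\<^sup>2 * A' * D') = a\<^sup>2 / \<alpha>\<^sup>2 * B * A * D * (A + D)"
proof -
  obtain x y where p: "p = (x, y)" and x: "x < 0" and curve: "curve_fun a \<alpha> x y = 0"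
    using assms by (cases p) (auto simp: on_curve_def)
  define x' where "x' = A\<^sup>2 / (a\<^sup>2 * \<alpha>\<^sup>2 * x)"
  define y' where "y' = - (x' - A / (\<alpha> * \<kappa>) * (x' - 1 / a\<^sup>2))"
  have p': "flow a \<alpha> p = (x', y')"
    unfolding x'_def A_def p y'_def by (rule flow_eq[OF x curve])
  have x': "x' < 0" and curve': "curve_fun a \<alpha> x' y' = 0"
    using on_curve_flow[OF assms(1)] by (simp_all add: p' on_curve_def)
  have "A > 0"
    unfolding A_def p by (rule fun_a_pos[OF x curve])
  have "A' > 0"
    unfolding A'_def p' by (rule fun_a_pos[OF x' curve'])
  have quad: "A\<^sup>2 * (1 - a\<^sup>2 * x) + 2 * a\<^sup>2 * \<alpha> * \<kappa> * x * A + a\<^sup>2 * \<alpha>\<^sup>2 * x * (x - a\<^sup>2) = 0"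
    using curve_imp_quadratic[OF x curve] unfolding A_def p .
  have AD: "A * D = - \<alpha>\<^sup>2 * x"
    unfolding A_def D_def p by (rule fun_a_times_fun_d[OF x curve])
  have AD': "A' * D' = - \<alpha>\<^sup>2 * x'"
    unfolding A'_def D'_def p' by (rule fun_a_times_fun_d[OF x' curve'])
  have D: "D = - \<alpha>\<^sup>2 * x / A"
    using AD \<open>A > 0\<close> by (simp add: field_simps)
  have B: "B = - 1 / (\<alpha> * a * x)" and B': "B' = - 1 / (\<alpha> * a * x')"
    unfolding B_def B'_def p' by (simp_all add: p fun_b_def)
  note nz = \<open>A > 0\<close> \<open>A' > 0\<close> x x' a_pos alpha_pos
  show 1: "B' * A' * D' = B * A * D"
    unfolding mult.assoc AD AD' B B' using nz by simp
  show "a\<^sup>2 / \<alpha>\<^sup>2 * B' * (A' * D')\<^sup>2 = B * A\<^sup>2"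
    unfolding AD' B B' using nz by (simp add: field_simps power2_eq_square) (simp add: x'_def field_simps power2_eq_square)
  show "B' = a\<^sup>2 / \<alpha>\<^sup>2 * B * D\<^sup>2"
    unfolding D B B' x'_def using nz by (simp add: field_simps power2_eq_square)
  have "A' * (1 - a\<^sup>2 * x') = a\<^sup>2 * \<alpha> * \<kappa> * (y' - x')"
    using one_minus_pos[OF x'] unfolding A'_def p' fun_a_eq by simp
  also have "\<dots> = - 2 * a\<^sup>2 * \<alpha> * \<kappa> * x' + A * (a\<^sup>2 * x' - 1)"
    unfolding y'_def using curve_const_pos nz by (simp add: field_simps)
  finally have A': "A' * (1 - a\<^sup>2 * x') = - 2 * a\<^sup>2 * \<alpha> * \<kappa> * x' + A * (a\<^sup>2 * x' - 1)" .
  have "x * A * (A' * (1 - a\<^sup>2 * x')) = x' * (A\<^sup>2 - a ^ 4 * \<alpha>\<^sup>2 * x)"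
  proof -
    have "a\<^sup>2 * \<alpha>\<^sup>2 * x * x' = A\<^sup>2"
      using nz by (simp add: x'_def)
    then show ?thesis
      unfolding A' using quad by algebra
  qed
  then have "A' * (1 - a\<^sup>2 * x') = x' * (A\<^sup>2 - a ^ 4 * \<alpha>\<^sup>2 * x) / (x * A)"
    using nz by (simp add: nonzero_eq_divide_eq mult.commute)
  moreover have "1 + a\<^sup>2 / \<alpha>\<^sup>2 * A' * D' = 1 - a\<^sup>2 * x'"
    using AD' nz by (simp add: mult.assoc)
  ultimately have X: "A' * (1 + a\<^sup>2 / \<alpha>\<^sup>2 * A' * D') = x' * (A\<^sup>2 - a ^ 4 * \<alpha>\<^sup>2 * x) / (x * A)"
    by simp
  show 4: "B' * A' * (1 + a\<^sup>2 / \<alpha>\<^sup>2 * A' * D') = B * (A + a ^ 4 * D)"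
    unfolding mult.assoc[of B' A' "1 + _"] X unfolding B B' D
    using nz by (simp add: field_simps power2_eq_square)
  show "B' * D' * (a ^ 4 + a\<^sup>2 / \<alpha>\<^sup>2 * A' * D') = a\<^sup>2 / \<alpha>\<^sup>2 * B * A * D * (A + D)"
    using factor_trace[OF assms(1)] factor_trace[OF on_curve_flow[OF assms(1)]] 4
    unfolding A_def[symmetric] B_def[symmetric] D_def[symmetric]
      A'_def[symmetric] B'_def[symmetric] D'_def[symmetric]
    by algebra
qed

text \<open>With \<open>B A D\<close> kept together, the entries of the two products match term by term under the relations of
  the flow.\<close>

lemma
  fixes A B D c z :: complex and p :: "real \<times> real"
  assumes "z \<noteq> 0"
  defines "A \<equiv> of_real (fun_a a \<alpha> p)" and "B \<equiv> of_real (fun_b a \<alpha> p)"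
    and "D \<equiv> of_real (fun_d a \<alpha> p)" and "c \<equiv> of_real (a\<^sup>2 / \<alpha>\<^sup>2)"
  shows minus_step_mult_plus_step: "minus_step a \<alpha> p z ** plus_step a \<alpha> p z =
      mat2 (B * A * (1 + c * A * D)) ((of_real a)\<^sup>2 * (B * A * D) * z + c * B * (A * D)\<^sup>2)
           ((of_real a)\<^sup>2 * B / z + c * (B * A * D)) (B * D * (of_real a ^ 4 + c * A * D))"
    and plus_step_mult_minus_step: "plus_step a \<alpha> p z ** minus_step a \<alpha> p z =
      mat2 (B * (A + of_real a ^ 4 * D)) ((of_real a)\<^sup>2 * (B * A * D) * z + B * A\<^sup>2)
           ((of_real a)\<^sup>2 * (c * B * D\<^sup>2) / z + c * (B * A * D)) (c * B * A * D * (A + D))"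
proof -
  have steps: "minus_step a \<alpha> p z = B *m (mat2 A 0 0 1 ** mat2 1 1 ((of_real a)\<^sup>2 / z) 1 ** mat2 1 0 0 A)"
    "plus_step a \<alpha> p z = mat2 1 0 0 (c * D) ** mat2 1 ((of_real a)\<^sup>2 * z) 1 1 ** mat2 1 0 0 D"
    unfolding minus_step_def plus_step_def A_def B_def D_def c_def by simp_all
  show "minus_step a \<alpha> p z ** plus_step a \<alpha> p z =
      mat2 (B * A * (1 + c * A * D)) ((of_real a)\<^sup>2 * (B * A * D) * z + c * B * (A * D)\<^sup>2)
           ((of_real a)\<^sup>2 * B / z + c * (B * A * D)) (B * D * (of_real a ^ 4 + c * A * D))"
    unfolding steps using assms(1)
    by (simp add: cmat_eq_iff cmat_mult_nth divide_simps)
       (simp add: algebra_simps power2_eq_square power4_eq_xxxx)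
  show "plus_step a \<alpha> p z ** minus_step a \<alpha> p z =
      mat2 (B * (A + of_real a ^ 4 * D)) ((of_real a)\<^sup>2 * (B * A * D) * z + B * A\<^sup>2)
           ((of_real a)\<^sup>2 * (c * B * D\<^sup>2) / z + c * (B * A * D)) (c * B * A * D * (A + D))"
    unfolding steps using assms(1)
    by (simp add: cmat_eq_iff cmat_mult_nth divide_simps)
       (simp add: algebra_simps power2_eq_square power4_eq_xxxx)
qed

lemma plus_minus_step_flow:
  assumes "on_curve p" "z \<noteq> 0"
  shows "plus_step a \<alpha> p z ** minus_step a \<alpha> p z =
    minus_step a \<alpha> (flow a \<alpha> p) z ** plus_step a \<alpha> (flow a \<alpha> p) z"
proof -
  note rel = flow_relations[OF assms(1), THEN arg_cong[where f = complex_of_real],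
      unfolded of_real_mult of_real_add of_real_power of_real_1]
  show ?thesis
    unfolding minus_step_mult_plus_step[OF assms(2)] plus_step_mult_minus_step[OF assms(2)]
    by (simp only: rel[symmetric])
qed

lemma minus_plus_step_start:
  assumes "z \<noteq> 0"
  shows "minus_step a \<alpha> (start_pt \<alpha>) z ** plus_step a \<alpha> (start_pt \<alpha>) z = P_mat a \<alpha> z"
proof -
  have "1 + \<alpha>\<^sup>2 > 0" "1 + a\<^sup>2 > 0"
    by (simp_all add: add_pos_nonneg)
  have "- ((1 - \<alpha>\<^sup>2) / (1 + \<alpha>\<^sup>2)) - (- 1) = 2 * \<alpha>\<^sup>2 / (1 + \<alpha>\<^sup>2)"
    using \<open>1 + \<alpha>\<^sup>2 > 0\<close> by (simp add: divide_simps)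
  then have "fun_a a \<alpha> (start_pt \<alpha>) =
      a * (1 + a\<^sup>2) * (1 + \<alpha>\<^sup>2) / 2 * (2 * \<alpha>\<^sup>2 / (1 + \<alpha>\<^sup>2) / (1 + a\<^sup>2))"
    unfolding fun_a_def start_pt_def by (simp only: prod.case) (simp add: add.commute)
  then have A: "fun_a a \<alpha> (start_pt \<alpha>) = a * \<alpha>\<^sup>2"
    using \<open>1 + \<alpha>\<^sup>2 > 0\<close> \<open>1 + a\<^sup>2 > 0\<close> by simp
  have B: "fun_b a \<alpha> (start_pt \<alpha>) = 1 / (a * \<alpha>)"
    by (simp add: fun_b_def start_pt_def mult.commute)
  have D: "fun_d a \<alpha> (start_pt \<alpha>) = 1 / a"
  proof -
    have "fun_a a \<alpha> (start_pt \<alpha>) * fun_d a \<alpha> (start_pt \<alpha>) = \<alpha>\<^sup>2"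
      using fun_a_times_fun_d[of "fst (start_pt \<alpha>)" "snd (start_pt \<alpha>)"] on_curve_start
      by (simp add: on_curve_def start_pt_def)
    then show ?thesis
      unfolding A using a_pos alpha_pos by (simp add: field_simps)
  qed
  show ?thesis
    unfolding minus_step_mult_plus_step[OF assms] A B D P_mat_def A_odd_def A_even_num_def
    using assms a_pos alpha_pos
    by (simp add: cmat_eq_iff cmat_mult_nth divide_simps)
       (simp add: algebra_simps power2_eq_square power4_eq_xxxx)
qed

lemma P_minus_eq: "P_minus a \<alpha> N z = mprod (\<lambda>j. minus_step a \<alpha> (orbit a \<alpha> j) z) [0..<N]"
  by (simp add: P_minus_def minus_step_def)

lemma P_plus_eq: "P_plus a \<alpha> N z = mprod (\<lambda>j. plus_step a \<alpha> (orbit a \<alpha> (N - 1 - j)) z) [0..<N]"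
  by (simp add: P_plus_def plus_step_def)

theorem P_power_factorization:
  assumes "z \<noteq> 0"
  shows "mpow (P_mat a \<alpha> z) N = P_minus a \<alpha> N z ** P_plus a \<alpha> N z"
proof -
  have "mpow (minus_step a \<alpha> (orbit a \<alpha> 0) z ** plus_step a \<alpha> (orbit a \<alpha> 0) z) N =
      P_minus a \<alpha> N z ** P_plus a \<alpha> N z"
    unfolding P_minus_eq P_plus_eq
    by (rule mpow_exchange)
       (simp add: plus_minus_step_flow[OF on_curve_orbit assms, unfolded orbit_def] orbit_def)
  then show ?thesis
    by (simp add: orbit_def minus_plus_step_start assms)
qed

lemma det_P_minus_nonzero:
  assumes "z \<noteq> of_real (a\<^sup>2)"
  shows "det (P_minus a \<alpha> N z) \<noteq> 0"
  unfolding P_minus_eq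
proof (rule det_mprod_nonzero)
  fix j
  obtain x y where p: "orbit a \<alpha> j = (x, y)" and x: "x < 0" and curve: "curve_fun a \<alpha> x y = 0"
    using on_curve_orbit[of j] by (cases "orbit a \<alpha> j") (auto simp: on_curve_def)
  have "fun_a a \<alpha> (x, y) \<noteq> 0" "fun_b a \<alpha> (x, y) \<noteq> 0"
    using fun_a_pos[OF x curve] x a_pos alpha_pos by (simp_all add: fun_b_def)
  then show "det (minus_step a \<alpha> (orbit a \<alpha> j) z) \<noteq> 0"
    using assms a_pos unfolding p minus_step_def by (auto simp: det_mul divide_simps)
qed

lemma det_P_plus_nonzero:
  assumes "of_real (a\<^sup>2) * z \<noteq> 1"
  shows "det (P_plus a \<alpha> N z) \<noteq> 0"
  unfolding P_plus_eq
proof (rule det_mprod_nonzero)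
  fix i
  define j where "j = N - 1 - i"
  obtain x y where p: "orbit a \<alpha> j = (x, y)" and x: "x < 0" and curve: "curve_fun a \<alpha> x y = 0"
    using on_curve_orbit[of j] by (cases "orbit a \<alpha> j") (auto simp: on_curve_def)
  have "fun_d a \<alpha> (x, y) \<noteq> 0"
    using fun_a_times_fun_d[OF x curve] x alpha_pos by auto
  then show "det (plus_step a \<alpha> (orbit a \<alpha> (N - 1 - i)) z) \<noteq> 0"
    using assms a_pos alpha_pos unfolding j_def[symmetric] p plus_step_def by (auto simp: det_mul)
qed

lemma mat_holomorphic_P_minus:
  assumes "0 \<notin> S"
  shows "mat_holomorphic_on (P_minus a \<alpha> N) S"
  unfolding P_minus_eq[abs_def] minus_step_def
  by (intro mat_holomorphic_on_mprod mat_holomorphic_on_mscale mat_holomorphic_on_mult mat_holomorphic_onI)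
     (use assms in \<open>auto intro!: holomorphic_intros\<close>)

lemma mat_holomorphic_P_plus: "mat_holomorphic_on (P_plus a \<alpha> N) S"
  unfolding P_plus_eq[abs_def] plus_step_def
  by (intro mat_holomorphic_on_mprod mat_holomorphic_on_mscale mat_holomorphic_on_mult mat_holomorphic_onI)
     (auto intro!: holomorphic_intros)

text \<open>The factors depend on \<open>z\<close> only through \<open>a\<^sup>2 / z\<close>. Since division by zero yields zero, the value of this
  quotient at \<open>z = 0\<close> is its limit at infinity.\<close>

lemma tendsto_P_minus: "(P_minus a \<alpha> N \<longlongrightarrow> P_minus a \<alpha> N 0) at_infinity"
  unfolding P_minus_eq[abs_def]
proof (rule tendsto_mprod)
  fix j
  have "((\<lambda>z. of_real (a\<^sup>2) / z) \<longlongrightarrow> complex_of_real (a\<^sup>2) / 0) at_infinity"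
    using tendsto_mult[OF tendsto_const tendsto_inverse_0, of "complex_of_real (a\<^sup>2)"]
    by (simp add: divide_inverse)
  note lim = this
  show "(minus_step a \<alpha> (orbit a \<alpha> j) \<longlongrightarrow> minus_step a \<alpha> (orbit a \<alpha> j) 0) at_infinity"
    unfolding minus_step_def
    by (intro tendsto_cmatI; simp only: cmat_mult_nth mat2_nth mscale_nth)
       (intro tendsto_add tendsto_mult tendsto_const lim)+
qed

end

section \<open>Uniqueness of Wiener--Hopf factorizations\<close>

lemma mat_eq_on_annulus:
  assumes "mat_holomorphic_on F (annulus a)" "\<And>z. cmod z = 1 \<Longrightarrow> F z = M"
    "0 < a" "a < 1" "z \<in> annulus a"
  shows "F z = M"
proof -
  have op: "open (annulus a)"
    unfolding annulus_def
    by (intro open_Collect_conj open_Collect_less continuous_on_const continuous_on_norm continuous_on_id)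
  have conn: "connected (annulus a)"
    using connected_annulus(1)[of "a\<^sup>2" "0 :: complex" "1 / a\<^sup>2"] by (simp add: annulus_def DIM_complex)
  have "a\<^sup>2 < 1"
    using assms(3,4) by (simp add: power_less_one_iff)
  then have sub: "sphere 0 1 \<subseteq> annulus a"
    using assms(3) by (auto simp: annulus_def)
  have lim: "(1 :: complex) islimpt sphere 0 1"
  proof (rule connected_imp_perfect)
    show "connected (sphere (0 :: complex) 1)"
      by (simp add: connected_sphere)
    have two_points: "(- 1 :: complex) \<in> sphere 0 1" "(1 :: complex) \<in> sphere 0 1"
      by simp_all
    show "sphere (0 :: complex) 1 \<noteq> {x}" for x
    proof
      assume "sphere 0 1 = {x}"
      then have "- 1 = x" "1 = x"
        using two_points by fast+
      then show False
        by (metis one_neq_neg_one)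
    qed
  qed simp
  have one: "1 \<in> annulus a"
    using \<open>a\<^sup>2 < 1\<close> assms(3) by (simp add: annulus_def)
  have "F z $ i $ j - M $ i $ j = 0" for i j
  proof (rule analytic_continuation[OF _ op conn sub one lim _ assms(5)])
    show "(\<lambda>z. F z $ i $ j - M $ i $ j) holomorphic_on annulus a"
      by (intro holomorphic_on_diff holomorphic_on_const mat_holomorphic_on_nth assms(1))
    show "F z $ i $ j - M $ i $ j = 0" if "z \<in> sphere 0 1" for z
      using that assms(2)[of z] by simp
  qed
  then show ?thesis
    by (simp add: vec_eq_iff)
qed

text \<open>Two factorizations \<open>F G = F1 G1\<close> on the circle give \<open>F1\<^sup>-\<^sup>1 F = G1 G\<^sup>-\<^sup>1\<close> there, and by Liouville's theorem
  both sides would be the constant limit \<open>I\<close> at infinity. As the inverses of \<open>F\<close> and \<open>G\<close> are only known to exist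
  on one side of the unit circle, the argument runs with \<open>H = F1\<^sup>-\<^sup>1 F\<close> on \<open>|z| > a\<^sup>2\<close> and \<open>K = G G1\<^sup>-\<^sup>1\<close> on
  \<open>|z| < a\<^sup>-\<^sup>2\<close>: the relation \<open>H K = I\<close> extends from the circle to the annulus, so \<open>K\<close> and \<open>F\<^sup>-\<^sup>1 F1\<close> agree
  on \<open>1 < |z| < a\<^sup>-\<^sup>2\<close> and together form an entire function.\<close>

lemma wiener_hopf_unique:
  assumes a: "0 < a" "a < 1"
    and wh: "wiener_hopf a A F G"
    and F1: "mat_holomorphic_on F1 {z. a\<^sup>2 < cmod z}" "\<And>z. a\<^sup>2 < cmod z \<Longrightarrow> det (F1 z) \<noteq> 0"
      "(F1 \<longlongrightarrow> mat 1) at_infinity"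
    and G1: "mat_holomorphic_on G1 {z. cmod z < 1 / a\<^sup>2}" "\<And>z. cmod z < 1 / a\<^sup>2 \<Longrightarrow> det (G1 z) \<noteq> 0"
    and A: "\<And>z. cmod z = 1 \<Longrightarrow> A z = F1 z ** G1 z"
    and z: "z \<in> annulus a"
  shows "F z = F1 z" "G z = G1 z"
proof -
  have "a\<^sup>2 < 1"
    using a by (simp add: power_less_one_iff)
  moreover from this have "1 < 1 / a\<^sup>2"
    using a by (simp add: less_divide_eq)
  ultimately have a2: "a\<^sup>2 < 1" "1 < 1 / a\<^sup>2" .
  have wh_mult: "\<And>z. cmod z = 1 \<Longrightarrow> A z = F z ** G z"
    and wh_F_inv: "\<And>z. 1 \<le> cmod z \<Longrightarrow> invertible (F z)"
    and wh_F: "mat_holomorphic_on F {z. 1 < cmod z}" "mat_holomorphic_on F (annulus a)"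
    and wh_G: "mat_holomorphic_on G {z. cmod z < 1}" "mat_holomorphic_on G (annulus a)"
    and wh_inv_F: "mat_holomorphic_on (\<lambda>z. matrix_inv (F z)) {z. 1 < cmod z}"
    and wh_lim: "(F \<longlongrightarrow> mat 1) at_infinity"
    using wh unfolding wiener_hopf_def by blast+
  have open_sets: "open (annulus a)" "open {z. 1 < cmod z}" "open {z. cmod z < 1}" "open {z. cmod z < 1 / a\<^sup>2}"
    unfolding annulus_def
    by (intro open_Collect_conj open_Collect_less continuous_on_const continuous_on_norm continuous_on_id)+
  have "{z. a\<^sup>2 < cmod z} = {z. 1 < cmod z} \<union> annulus a"
    using a2 by (auto simp: annulus_def)
  then have F: "mat_holomorphic_on F {z. a\<^sup>2 < cmod z}"
    by (simp only:) (intro mat_holomorphic_on_Un wh_F open_sets)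
  have "{z. cmod z < 1 / a\<^sup>2} = {z. cmod z < 1} \<union> annulus a"
    using a2 by (auto simp: annulus_def)
  then have G: "mat_holomorphic_on G {z. cmod z < 1 / a\<^sup>2}"
    by (simp only:) (intro mat_holomorphic_on_Un wh_G open_sets)
  define H where "H = (\<lambda>z. matrix_inv (F1 z) ** F z)"
  define K where "K = (\<lambda>z. G z ** matrix_inv (G1 z))"
  have H: "mat_holomorphic_on H {z. a\<^sup>2 < cmod z}"
    unfolding H_def using F F1(1,2)
    by (intro mat_holomorphic_on_mult mat_holomorphic_on_matrix_inv) auto
  have K: "mat_holomorphic_on K {z. cmod z < 1 / a\<^sup>2}"
    unfolding K_def using G G1(1,2)
    by (intro mat_holomorphic_on_mult mat_holomorphic_on_matrix_inv) auto
  have HK: "H z ** K z = mat 1" if "z \<in> annulus a" for z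
  proof (rule mat_eq_on_annulus[of "\<lambda>z. H z ** K z"])
    show "mat_holomorphic_on (\<lambda>z. H z ** K z) (annulus a)"
      by (intro mat_holomorphic_on_mult mat_holomorphic_on_subset[OF H] mat_holomorphic_on_subset[OF K])
         (auto simp: annulus_def)
  next
    fix z :: complex
    assume z: "cmod z = 1"
    then have "det (F1 z) \<noteq> 0" "det (G1 z) \<noteq> 0" "F z ** G z = F1 z ** G1 z"
      using F1(2)[of z] G1(2)[of z] A[of z] wh_mult[of z] a2 by simp_all
    have "H z ** K z = matrix_inv (F1 z) ** (F z ** G z) ** matrix_inv (G1 z)"
      unfolding H_def K_def by (simp only: matrix_mul_assoc)
    also have "\<dots> = matrix_inv (F1 z) ** (F1 z ** G1 z) ** matrix_inv (G1 z)"
      by (simp only: \<open>F z ** G z = F1 z ** G1 z\<close>)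
    also have "\<dots> = (matrix_inv (F1 z) ** F1 z) ** (G1 z ** matrix_inv (G1 z))"
      by (simp only: matrix_mul_assoc)
    finally show "H z ** K z = mat 1"
      using \<open>det (F1 z) \<noteq> 0\<close> \<open>det (G1 z) \<noteq> 0\<close> by (simp add: matrix_inv_mult mult_matrix_inv)
  qed (use a that in auto)
  have FK: "F z ** K z = F1 z" if "z \<in> annulus a" for z
  proof -
    have "F1 z ** (H z ** K z) = F1 z ** matrix_inv (F1 z) ** F z ** K z"
      unfolding H_def by (simp only: matrix_mul_assoc)
    then show ?thesis
      using that F1(2)[of z] by (simp add: HK mult_matrix_inv annulus_def)
  qed
  define L where "L = (\<lambda>z. matrix_inv (F z) ** F1 z)"
  have L: "mat_holomorphic_on L {z. 1 < cmod z}"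
    unfolding L_def
    by (intro mat_holomorphic_on_mult mat_holomorphic_on_subset[OF F1(1)] wh_inv_F) (use a2 in auto)
  have K_eq_L: "K z = L z" if "cmod z < 1 / a\<^sup>2" "1 < cmod z" for z
  proof -
    have "z \<in> annulus a"
      using that a2 by (simp add: annulus_def)
    have "det (F z) \<noteq> 0"
      using wh_F_inv[of z] that by (simp add: invertible_det_nz)
    then have "K z = matrix_inv (F z) ** (F z ** K z)"
      by (simp add: matrix_mul_assoc matrix_inv_mult)
    then show ?thesis
      by (simp add: L_def FK \<open>z \<in> annulus a\<close>)
  qed
  \<comment> \<open>\<open>K\<close> inside and \<open>F\<^sup>-\<^sup>1 F1\<close> outside, glued to an entire function\<close>
  define E where "E = (\<lambda>z. if z \<in> {z. cmod z < 1 / a\<^sup>2} then K z else L z)"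
  have "mat_holomorphic_on E ({z. cmod z < 1 / a\<^sup>2} \<union> {z. 1 < cmod z})"
    unfolding E_def by (rule mat_holomorphic_on_If_Un[OF K L]) (use open_sets K_eq_L in auto)
  moreover have "{z. cmod z < 1 / a\<^sup>2} \<union> {z. 1 < cmod z} = UNIV"
    using a2 by auto
  ultimately have "mat_holomorphic_on E UNIV"
    by simp
  moreover have "(E \<longlongrightarrow> mat 1) at_infinity"
  proof (rule Lim_transform_eventually)
    have "((\<lambda>z. matrix_inv (F z)) \<longlongrightarrow> matrix_inv (mat 1)) at_infinity"
      using wh_lim by (rule tendsto_matrix_inv) simp
    then have "(L \<longlongrightarrow> matrix_inv (mat 1) ** mat 1) at_infinity"
      unfolding L_def by (rule tendsto_cmat_mult) (rule F1(3))
    then show "(L \<longlongrightarrow> mat 1) at_infinity"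
      by (simp add: matrix_inv_eqI[of "mat 1" "mat 1"])
    show "\<forall>\<^sub>F z in at_infinity. L z = E z"
      unfolding eventually_at_infinity E_def by (intro exI[of _ "1 / a\<^sup>2"]) auto
  qed
  ultimately have "E z = mat 1"
    by (rule mat_Liouville)
  then have "K z = mat 1"
    using z by (simp add: E_def annulus_def)
  then show "F z = F1 z"
    using FK[OF z] by simp
  have "G z = K z ** G1 z"
    using z G1(2)[of z] by (simp add: K_def annulus_def matrix_inv_mult flip: matrix_mul_assoc)
  then show "G z = G1 z"
    by (simp add: \<open>K z = mat 1\<close>)
qed

section \<open>Changing the radii of the contours\<close>

lemma circle_int_cong:
  assumes "0 < r" "\<And>z. cmod z = r \<Longrightarrow> F z = G z"
  shows "circle_int r F = circle_int r G"
proof -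
  have "contour_integral (circlepath 0 r) (\<lambda>z. F z $ i $ j) =
      contour_integral (circlepath 0 r) (\<lambda>z. G z $ i $ j)" for i j
    by (rule contour_integral_eq) (use assms in auto)
  then show ?thesis
    by (simp add: circle_int_def)
qed

text \<open>Radial segments deform one circle into the other within the annulus.\<close>

lemma circle_int_radius:
  assumes "mat_holomorphic_on F {z. l < cmod z \<and> cmod z < u}" "0 \<le> l"
    "l < r" "r < u" "l < s" "s < u"
  shows "circle_int r F = circle_int s F"
proof -
  define S where "S = {z. l < cmod z \<and> cmod z < u}"
  have "homotopic_loops S (circlepath 0 r) (circlepath 0 s)"
  proof (rule homotopic_loops_linear)
    fix t :: real
    show "closed_segment (circlepath 0 r t) (circlepath 0 s t) \<subseteq> S"
    proof
      fix x
      assume "x \<in> closed_segment (circlepath 0 r t) (circlepath 0 s t)"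
      then obtain v where v: "0 \<le> v" "v \<le> 1"
        and x: "x = (1 - v) *\<^sub>R circlepath 0 r t + v *\<^sub>R circlepath 0 s t"
        by (auto simp: closed_segment_def)
      have "x = of_real ((1 - v) * r + v * s) * exp (2 * of_real pi * \<i> * of_real t)"
        unfolding x by (simp add: circlepath scaleR_conv_of_real algebra_simps)
      then have "cmod x = \<bar>(1 - v) * r + v * s\<bar>"
        by (simp add: norm_mult norm_exp_eq_Re del: of_real_add of_real_mult)
      moreover have "l < (1 - v) * r + v * s" "(1 - v) * r + v * s < u"
        using convex_bound_lt[of "- r" "- l" "- s" "1 - v" v] convex_bound_lt[of r u s "1 - v" v] v assms
        by simp_all
      ultimately show "x \<in> S"
        using assms(2) by (auto simp: S_def)
    qed
  qed auto
  moreover have "open S"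
    unfolding S_def Collect_conj_eq by (intro open_Int open_Collect_less continuous_intros)
  ultimately have "contour_integral (circlepath 0 r) (\<lambda>z. F z $ i $ j) =
      contour_integral (circlepath 0 s) (\<lambda>z. F z $ i $ j)" for i j
    by (rule Cauchy_theorem_homotopic_loops) (use assms(1) in \<open>auto simp: S_def intro: mat_holomorphic_on_nth\<close>)
  then show ?thesis
    by (simp add: circle_int_def)
qed

lemma circle_int_mult_left:
  assumes "0 < r" "continuous_on (sphere 0 r) F"
  shows "circle_int r (\<lambda>z. M ** F z) = M ** circle_int r F"
proof -
  have "(\<lambda>z. c * F z $ i $ j) contour_integrable_on circlepath 0 r" for c i j
    using assms by (intro contour_integrable_continuous_circlepath continuous_intros) simp
  moreover from this[of 1] have "(\<lambda>z. F z $ i $ j) contour_integrable_on circlepath 0 r" for i j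
    by simp
  ultimately show ?thesis
    by (simp add: vec_eq_iff circle_int_def cmat_mult_nth contour_integral_add contour_integral_lmul)
qed

text \<open>The Cauchy kernel allows differentiation under the integral sign off the circle.\<close>

lemma mat_holomorphic_on_Cauchy_transform:
  assumes "0 < r" "continuous_on (sphere 0 r) V"
  shows "mat_holomorphic_on (\<lambda>w. circle_int r (\<lambda>z. (1 / (z - w)) *m V z)) {w. cmod w < r}"
  unfolding mat_holomorphic_on_def
proof (intro allI)
  fix i j
  define g where "g = (\<lambda>w. contour_integral (circlepath 0 r) (\<lambda>z. V z $ i $ j / (z - w) ^ 1))"
  have cont: "continuous_on (path_image (circlepath 0 r)) (\<lambda>z. V z $ i $ j)"
    using assms by (intro continuous_intros) simp
  have int: "((\<lambda>z. V z $ i $ j / (z - w) ^ 1) has_contour_integral g w) (circlepath 0 r)"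
    if "w \<in> ball 0 r" for w
    unfolding g_def using that assms(1)
    by (intro has_contour_integral_integral contour_integrable_continuous_circlepath
        continuous_intros cont) auto
  have "\<exists>D. (g has_field_derivative D) (at w)" if "w \<in> ball 0 r" for w
    using Cauchy_next_derivative_circlepath(2)[OF cont int _ that] by auto
  then have "g holomorphic_on ball 0 r"
    by (simp add: holomorphic_on_open)
  moreover have "ball 0 r = {w :: complex. cmod w < r}"
    by auto
  ultimately show "(\<lambda>w. circle_int r (\<lambda>z. (1 / (z - w)) *m V z) $ i $ j) holomorphic_on {w. cmod w < r}"
    by (simp add: circle_int_def g_def)
qed

text \<open>For \<open>|w| < r\<close> the inner integral equals \<open>U(w) C\<^sub>r(w)\<close>, where \<open>C\<^sub>r\<close> is the Cauchy transform of \<open>V\<close>. It does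
  not depend on \<open>r\<close> as long as the circle stays outside \<open>w\<close>, and it is holomorphic in the disc. So both inner
  circles can be replaced by the larger one of them, which leaves room to move the outer circle.\<close>

lemma double_circle_int_radii:
  assumes U: "mat_holomorphic_on U {z. l < cmod z \<and> cmod z < u}"
    and V: "mat_holomorphic_on V {z. l < cmod z \<and> cmod z < u}"
    and "0 \<le> l" "l < r\<^sub>1" "r\<^sub>1 < r\<^sub>2" "r\<^sub>2 < u" "l < \<rho>\<^sub>1" "\<rho>\<^sub>1 < \<rho>\<^sub>2" "\<rho>\<^sub>2 < u"
  shows "circle_int r\<^sub>1 (\<lambda>w. circle_int r\<^sub>2 (\<lambda>z. (1 / (z - w)) *m (U w ** V z))) =
    circle_int \<rho>\<^sub>1 (\<lambda>w. circle_int \<rho>\<^sub>2 (\<lambda>z. (1 / (z - w)) *m (U w ** V z)))"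
proof -
  define C where "C = (\<lambda>r w. circle_int r (\<lambda>z. (1 / (z - w)) *m V z))"
  have V_cont: "continuous_on (sphere 0 r) V" if "l < r" "r < u" for r
    using mat_holomorphic_on_imp_continuous_on[OF V]
    by (rule continuous_on_subset) (use that in auto)
  have inner: "circle_int r (\<lambda>z. (1 / (z - w)) *m (U w ** V z)) = U w ** C r w"
    if "l < r" "r < u" "cmod w < r" for r w
  proof -
    have "continuous_on (sphere 0 r) (\<lambda>z. (1 / (z - w)) *m V z)"
      using that assms(3) V_cont[of r]
      by (intro cmat_continuous_onI) (auto intro!: continuous_intros)
    then show ?thesis
      unfolding C_def using that assms(3) by (simp add: circle_int_mult_left flip: mscale_mult_right)
  qed
  have C_eq: "C r w = C s w" if "l < r" "r < u" "l < s" "s < u" "cmod w < r" "cmod w < s" for r s w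
    unfolding C_def
  proof (rule circle_int_radius[where l = "max l (cmod w)" and u = u])
    have "mat_holomorphic_on V {z. max l (cmod w) < cmod z \<and> cmod z < u}"
      by (rule mat_holomorphic_on_subset[OF V]) auto
    then show "mat_holomorphic_on (\<lambda>z. (1 / (z - w)) *m V z) {z. max l (cmod w) < cmod z \<and> cmod z < u}"
      by (intro mat_holomorphic_on_mscale holomorphic_intros) auto
  qed (use that assms(3) in auto)
  have outer: "circle_int r (\<lambda>w. circle_int s (\<lambda>z. (1 / (z - w)) *m (U w ** V z))) =
      circle_int r (\<lambda>w. U w ** C R w)"
    if "l < r" "r < s" "s \<le> R" "R < u" for r s R
    using that assms(3) by (intro circle_int_cong) (auto simp: inner intro!: arg_cong[of _ _ "(**) _"] C_eq)
  \<comment> \<open>A common radius for the inner circle that exceeds both outer radii.\<close>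
  define R where "R = max r\<^sub>2 \<rho>\<^sub>2"
  have "circle_int r\<^sub>1 (\<lambda>w. U w ** C R w) = circle_int \<rho>\<^sub>1 (\<lambda>w. U w ** C R w)"
  proof (rule circle_int_radius[where l = l and u = R])
    have R: "0 < R" "l < R" "R < u"
      using assms by (auto simp: R_def)
    then have "mat_holomorphic_on (C R) {w. cmod w < R}"
      unfolding C_def using V_cont[of R] by (intro mat_holomorphic_on_Cauchy_transform)
    then show "mat_holomorphic_on (\<lambda>w. U w ** C R w) {z. l < cmod z \<and> cmod z < R}"
      using R by (intro mat_holomorphic_on_mult mat_holomorphic_on_subset[OF U])
        (auto intro: mat_holomorphic_on_subset)
  qed (use assms in \<open>auto simp: R_def\<close>)
  then show ?thesis
    using assms by (simp add: outer[where R = R] R_def)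
qed

section \<open>Products of transition matrices\<close>

lemma det_A_odd: "0 < \<alpha> \<Longrightarrow> det (A_odd a \<alpha> z) = 1 - of_real (a\<^sup>2) * z"
  unfolding A_odd_def by (simp add: power2_eq_square)

lemma A_odd_mult_A_even:
  "A_odd a \<alpha> z ** A_even a z = (1 / (1 - of_real (a\<^sup>2) / z)) *m P_mat a \<alpha> z"
  by (simp add: A_even_def P_mat_def mscale_mult_right)

lemma mprod_A_step_even:
  "mprod (\<lambda>k. A_step a \<alpha> k z) [2 * m + 1..2 * (m + int n)] =
    (1 / (1 - of_real (a\<^sup>2) / z)) ^ n *m mpow (P_mat a \<alpha> z) n"
proof -
  have "mprod (\<lambda>k. A_step a \<alpha> k z) [2 * m + 1..2 * (m + int n)] =
      mpow (A_odd a \<alpha> z ** A_even a z) n"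
  proof (induction n arbitrary: m)
    case (Suc n)
    have "[2 * m + 1..2 * (m + int (Suc n))] =
        (2 * m + 1) # (2 * m + 2) # [2 * (m + 1) + 1..2 * ((m + 1) + int n)]"
      by (simp add: upto_rec1 algebra_simps)
    then show ?case
      by (simp only: mprod_Cons Suc.IH mpow_Suc) (simp add: A_step_def matrix_mul_assoc)
  qed simp
  then show ?thesis
    by (simp add: A_odd_mult_A_even mpow_mscale)
qed

text \<open>The product splits into consecutive pairs \<open>A\<^sub>o A\<^sub>e\<close>. If it starts with an even index, the missing \<open>A\<^sub>o\<close> of
  the first pair is compensated by its inverse; if it ends with an odd index, one \<open>A\<^sub>o\<close> is left over.\<close>

lemma mprod_A_step:
  assumes "0 < \<alpha>" "of_real (a\<^sup>2) * z \<noteq> 1" "\<epsilon> \<in> {0, 1}" "\<epsilon>' \<in> {0, 1}" "\<epsilon>' \<le> 2 * int n + \<epsilon>"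
  shows "mprod (\<lambda>k. A_step a \<alpha> k z) [2 * m + \<epsilon>' + 1..2 * (m + int n) + \<epsilon>] =
    (1 / (1 - of_real (a\<^sup>2) / z)) ^ n *m
      (mpowi (A_odd a \<alpha> z) (- \<epsilon>') ** mpow (P_mat a \<alpha> z) n ** mpowi (A_odd a \<alpha> z) \<epsilon>)"
proof -
  define T where "T = (\<lambda>i. mprod (\<lambda>k. A_step a \<alpha> k z) [i..2 * (m + int n) + \<epsilon>])"
  define R where "R = (1 / (1 - of_real (a\<^sup>2) / z)) ^ n *m
      (mpow (P_mat a \<alpha> z) n ** mpowi (A_odd a \<alpha> z) \<epsilon>)"
  have T: "T (2 * m + 1) = R"
  proof (cases "\<epsilon> = 0")
    case True
    then show ?thesis
      using mprod_A_step_even[of a \<alpha> z m n] by (simp add: T_def R_def)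
  next
    case False
    then have "\<epsilon> = 1"
      using assms(3) by simp
    then have "[2 * m + 1..2 * (m + int n) + \<epsilon>] =
        [2 * m + 1..2 * (m + int n)] @ [2 * (m + int n) + 1]"
      by (simp add: upto_rec2)
    moreover have "A_step a \<alpha> (2 * (m + int n) + 1) z = A_odd a \<alpha> z"
      by (simp add: A_step_def)
    ultimately have "T (2 * m + 1) = mprod (\<lambda>k. A_step a \<alpha> k z) [2 * m + 1..2 * (m + int n)] ** A_odd a \<alpha> z"
      by (simp only: T_def mprod_append) simp
    then show ?thesis
      unfolding mprod_A_step_even by (simp add: R_def \<open>\<epsilon> = 1\<close> mscale_mult_left)
  qed
  have "T (2 * m + \<epsilon>' + 1) = mpowi (A_odd a \<alpha> z) (- \<epsilon>') ** R"
  proof (cases "\<epsilon>' = 0")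
    case False
    then have "\<epsilon>' = 1"
      using assms(4) by simp
    then have "T (2 * m + 1) = A_odd a \<alpha> z ** T (2 * m + \<epsilon>' + 1)"
      using assms(5) unfolding T_def
      by (subst upto_rec1) (simp_all add: A_step_def add.commute)
    moreover have "det (A_odd a \<alpha> z) \<noteq> 0"
      using assms(1,2) by (simp add: det_A_odd)
    ultimately show ?thesis
      by (simp add: T[symmetric] \<open>\<epsilon>' = 1\<close> matrix_mul_assoc matrix_inv_mult)
  qed (simp add: T)
  then show ?thesis
    by (simp add: T_def R_def mscale_mult_right matrix_mul_assoc)
qed

section \<open>The factors of the symbol\<close>

context
  fixes a \<alpha> :: real and N :: nat
  assumes a: "0 < a" "a < 1" and alpha: "0 < \<alpha>"
begin

lemma outside_nonzero:
  assumes "a\<^sup>2 < cmod z"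
  shows "z \<noteq> 0" "z \<noteq> of_real (a\<^sup>2)" "1 - of_real (a\<^sup>2) / z \<noteq> 0"
proof -
  have "0 < a\<^sup>2"
    using a by simp
  then show "z \<noteq> 0"
    using assms by auto
  show "z \<noteq> of_real (a\<^sup>2)"
    using assms by (metis abs_of_nonneg norm_of_real order_less_irrefl zero_le_power2)
  then show "1 - of_real (a\<^sup>2) / z \<noteq> 0"
    using \<open>z \<noteq> 0\<close> by simp
qed

lemma inside_nonzero:
  assumes "cmod z < 1 / a\<^sup>2"
  shows "of_real (a\<^sup>2) * z \<noteq> 1"
proof
  assume "of_real (a\<^sup>2) * z = 1"
  then have "a\<^sup>2 * cmod z = 1"
    by (metis abs_of_nonneg norm_mult norm_of_real norm_one zero_le_power2)
  then show False
    using assms a by (simp add: field_simps)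
qed

text \<open>The factors \<open>P\<^sub>-\<close> and \<open>P\<^sub>+\<close>, normalized such that the first one tends to the identity. The normalizing
  matrix \<open>P_minus a \<alpha> N 0\<close> is the limit of \<open>P\<^sub>-\<close> at infinity, see \<open>tendsto_P_minus\<close>.\<close>

definition W_minus :: "complex \<Rightarrow> cmat" where
  "W_minus z = (1 / (1 - of_real (a\<^sup>2) / z)) ^ N *m (P_minus a \<alpha> N z ** matrix_inv (P_minus a \<alpha> N 0))"

definition W_plus :: "complex \<Rightarrow> cmat" where
  "W_plus z = P_minus a \<alpha> N 0 ** P_plus a \<alpha> N z"

lemma det_P_minus_0: "det (P_minus a \<alpha> N 0) \<noteq> 0"
  using a alpha by (intro det_P_minus_nonzero) auto

lemma det_inverse_P_minus_0: "det (matrix_inv (P_minus a \<alpha> N 0)) \<noteq> 0"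
  using arg_cong[OF mult_matrix_inv[OF det_P_minus_0], of det] by (auto simp: det_mul)

lemma det_W_minus: "a\<^sup>2 < cmod z \<Longrightarrow> det (W_minus z) \<noteq> 0"
  using outside_nonzero[of z] det_P_minus_nonzero[OF a(1) alpha, of z N] det_inverse_P_minus_0
  by (simp add: W_minus_def det_mul)

lemma det_W_plus: "cmod z < 1 / a\<^sup>2 \<Longrightarrow> det (W_plus z) \<noteq> 0"
  using inside_nonzero[of z] det_P_plus_nonzero[OF a(1) alpha, of z N] det_P_minus_0
  by (simp add: W_plus_def det_mul)

lemma mat_holomorphic_W_minus: "mat_holomorphic_on W_minus {z. a\<^sup>2 < cmod z}"
  unfolding W_minus_def[abs_def]
  by (intro mat_holomorphic_on_mscale mat_holomorphic_on_mult mat_holomorphic_on_const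
      mat_holomorphic_P_minus holomorphic_intros)
     (use outside_nonzero a alpha in auto)

lemma mat_holomorphic_W_plus: "mat_holomorphic_on W_plus S"
  unfolding W_plus_def[abs_def] using a alpha
  by (intro mat_holomorphic_on_mult mat_holomorphic_on_const mat_holomorphic_P_plus)

lemma W_minus_at_infinity: "(W_minus \<longlongrightarrow> mat 1) at_infinity"
proof -
  have "((\<lambda>z. of_real (a\<^sup>2) / z) \<longlongrightarrow> (0 :: complex)) at_infinity"
    using tendsto_mult[OF tendsto_const tendsto_inverse_0, of "complex_of_real (a\<^sup>2)"]
    by (simp add: divide_inverse)
  then have scalar: "((\<lambda>z. (1 / (1 - of_real (a\<^sup>2) / z)) ^ N) \<longlongrightarrow> (1 / (1 - 0 :: complex)) ^ N) at_infinity"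
    by (intro tendsto_power tendsto_divide tendsto_const tendsto_diff) auto
  have "((\<lambda>z. P_minus a \<alpha> N z ** matrix_inv (P_minus a \<alpha> N 0)) \<longlongrightarrow> mat 1) at_infinity"
    using tendsto_cmat_mult[OF tendsto_P_minus[OF a(1) alpha] tendsto_const,
        of N "matrix_inv (P_minus a \<alpha> N 0)"]
    by (simp add: mult_matrix_inv det_P_minus_0)
  note matrix = tendsto_vec_nth[OF tendsto_vec_nth[OF this]]
  show ?thesis
  proof (intro vec_tendstoI)
    fix i j
    show "((\<lambda>z. W_minus z $ i $ j) \<longlongrightarrow> mat 1 $ i $ j) at_infinity"
      using tendsto_mult[OF scalar matrix[of i j]] by (simp add: W_minus_def)
  qed
qed

lemma A_total_factorization:
  assumes "z \<in> annulus a"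
  shows "A_total a \<alpha> N z = W_minus z ** W_plus z"
proof -
  have "z \<noteq> 0"
    using assms outside_nonzero by (auto simp: annulus_def)
  have "A_total a \<alpha> N z = (1 / (1 - of_real (a\<^sup>2) / z)) ^ N *m mpow (P_mat a \<alpha> z) N"
    using mprod_A_step_even[of a \<alpha> z 0 N] by (simp add: A_total_def)
  also have "mpow (P_mat a \<alpha> z) N = P_minus a \<alpha> N z ** P_plus a \<alpha> N z"
    by (rule P_power_factorization[OF a(1) alpha \<open>z \<noteq> 0\<close>])
  also have "\<dots> = P_minus a \<alpha> N z ** (matrix_inv (P_minus a \<alpha> N 0) ** P_minus a \<alpha> N 0) ** P_plus a \<alpha> N z"
    by (simp add: matrix_inv_mult det_P_minus_0)
  finally show ?thesis
    by (simp add: W_minus_def W_plus_def mscale_mult_left matrix_mul_assoc)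
qed

lemma unit_circle_annulus: "cmod z = 1 \<Longrightarrow> z \<in> annulus a"
proof -
  have "a\<^sup>2 < 1"
    using a by (simp add: power_less_one_iff)
  then show "cmod z = 1 \<Longrightarrow> z \<in> annulus a"
    using a by (simp add: annulus_def less_divide_eq)
qed

lemma wiener_hopf_W: "wiener_hopf a (A_total a \<alpha> N) W_minus W_plus"
proof -
  have a2: "a\<^sup>2 < 1" "1 < 1 / a\<^sup>2"
    using unit_circle_annulus[of 1] by (simp_all add: annulus_def)
  have inv_minus: "mat_holomorphic_on (\<lambda>z. matrix_inv (W_minus z)) {z. a\<^sup>2 < cmod z}"
    by (rule mat_holomorphic_on_matrix_inv[OF mat_holomorphic_W_minus]) (simp add: det_W_minus)
  have inv_plus: "mat_holomorphic_on (\<lambda>z. matrix_inv (W_plus z)) {z. cmod z < 1 / a\<^sup>2}"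
    by (rule mat_holomorphic_on_matrix_inv[OF mat_holomorphic_W_plus]) (simp add: det_W_plus)
  have outside: "{z. 1 < cmod z} \<subseteq> {z. a\<^sup>2 < cmod z}" "{z. 1 \<le> cmod z} \<subseteq> {z. a\<^sup>2 < cmod z}"
    and inside: "{z. cmod z < 1} \<subseteq> {z. cmod z < 1 / a\<^sup>2}" "{z. cmod z \<le> 1} \<subseteq> {z. cmod z < 1 / a\<^sup>2}"
    using a2 by (force simp del: less_divide_eq_1)+
  show ?thesis
    unfolding wiener_hopf_def
  proof (intro conjI allI impI)
    show "A_total a \<alpha> N z = W_minus z ** W_plus z" if "cmod z = 1" for z
      by (rule A_total_factorization[OF unit_circle_annulus[OF that]])
    show "invertible (W_plus z)" if "cmod z \<le> 1" for z
      using that inside(2) det_W_plus[of z] by (auto simp: invertible_det_nz)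
    show "invertible (W_minus z)" if "1 \<le> cmod z" for z
      using that outside(2) det_W_minus[of z] by (auto simp: invertible_det_nz)
    show "mat_holomorphic_on W_plus {z. cmod z < 1}" "mat_holomorphic_on W_plus (annulus a)"
      by (rule mat_holomorphic_W_plus)+
    show "mat_holomorphic_on (\<lambda>z. matrix_inv (W_plus z)) {z. cmod z < 1}"
      by (rule mat_holomorphic_on_subset[OF inv_plus inside(1)])
    show "continuous_on {z. cmod z \<le> 1} W_plus"
      by (rule mat_holomorphic_on_imp_continuous_on[OF mat_holomorphic_W_plus])
    show "continuous_on {z. cmod z \<le> 1} (\<lambda>z. matrix_inv (W_plus z))"
      by (rule mat_holomorphic_on_imp_continuous_on[OF mat_holomorphic_on_subset[OF inv_plus inside(2)]])
    show "mat_holomorphic_on W_minus {z. 1 < cmod z}"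
      by (rule mat_holomorphic_on_subset[OF mat_holomorphic_W_minus outside(1)])
    show "mat_holomorphic_on W_minus (annulus a)"
      by (rule mat_holomorphic_on_subset[OF mat_holomorphic_W_minus]) (auto simp: annulus_def)
    show "mat_holomorphic_on (\<lambda>z. matrix_inv (W_minus z)) {z. 1 < cmod z}"
      by (rule mat_holomorphic_on_subset[OF inv_minus outside(1)])
    show "continuous_on {z. 1 \<le> cmod z} W_minus"
      by (rule mat_holomorphic_on_imp_continuous_on[OF mat_holomorphic_on_subset[OF mat_holomorphic_W_minus outside(2)]])
    show "continuous_on {z. 1 \<le> cmod z} (\<lambda>z. matrix_inv (W_minus z))"
      by (rule mat_holomorphic_on_imp_continuous_on[OF mat_holomorphic_on_subset[OF inv_minus outside(2)]])
    show "(W_minus \<longlongrightarrow> mat 1) at_infinity"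
      by (rule W_minus_at_infinity)
  qed
qed

text \<open>The definition of the kernel chooses some factorization. One exists by \<open>wiener_hopf_W\<close>, and uniqueness
  identifies the chosen one on the annulus, where the contours lie.\<close>

lemma wiener_hopf_factors:
  assumes "z \<in> annulus a"
  shows "A_minus a \<alpha> N z = W_minus z" "A_plus a \<alpha> N z = W_plus z"
proof -
  have "(\<lambda>(F, G). wiener_hopf a (A_total a \<alpha> N) F G) (wh_pair a \<alpha> N)"
    unfolding wh_pair_def by (rule someI[of _ "(W_minus, W_plus)"]) (simp add: wiener_hopf_W)
  then have "wiener_hopf a (A_total a \<alpha> N) (A_minus a \<alpha> N) (A_plus a \<alpha> N)"
    by (simp add: A_minus_def A_plus_def case_prod_beta)
  note unique = wiener_hopf_unique[OF a this mat_holomorphic_W_minus det_W_minus W_minus_at_infinity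
      mat_holomorphic_W_plus det_W_plus A_total_factorization[OF unit_circle_annulus] assms]
  show "A_minus a \<alpha> N z = W_minus z" "A_plus a \<alpha> N z = W_plus z"
    by (rule unique; assumption)+
qed

text \<open>The normalizing matrix cancels between the two inverses.\<close>

lemma inverse_wiener_hopf_factors:
  assumes "w \<in> annulus a" "z \<in> annulus a"
  shows "matrix_inv (A_plus a \<alpha> N w) ** matrix_inv (A_minus a \<alpha> N z) =
    (1 - of_real (a\<^sup>2) / z) ^ N *m (matrix_inv (P_plus a \<alpha> N w) ** matrix_inv (P_minus a \<alpha> N z))"
proof -
  define L where "L = P_minus a \<alpha> N 0"
  define s where "s = 1 - of_real (a\<^sup>2) / z"
  have L: "det L \<noteq> 0" "det (matrix_inv L) \<noteq> 0"
    unfolding L_def by (rule det_P_minus_0 det_inverse_P_minus_0)+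
  have z: "s \<noteq> 0" "det (P_minus a \<alpha> N z) \<noteq> 0"
    using assms outside_nonzero[of z] a alpha det_P_minus_nonzero[of a \<alpha> z N] by (auto simp: annulus_def s_def)
  have w: "det (P_plus a \<alpha> N w) \<noteq> 0"
    using assms inside_nonzero[of w] a alpha det_P_plus_nonzero[of a \<alpha> w N] by (auto simp: annulus_def)
  have "matrix_inv (matrix_inv L) = L"
    by (rule matrix_inv_eqI) (simp add: matrix_inv_mult L)
  then have minus: "matrix_inv (W_minus z) =
      s ^ N *m (L ** matrix_inv (P_minus a \<alpha> N z))"
    using z L unfolding W_minus_def L_def[symmetric] s_def[symmetric]
    by (simp add: matrix_inv_mscale matrix_inv_product det_mul power_one_over)
  have plus: "matrix_inv (W_plus w) = matrix_inv (P_plus a \<alpha> N w) ** matrix_inv L"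
    using w L unfolding W_plus_def L_def[symmetric] by (simp add: matrix_inv_product)
  have "matrix_inv (P_plus a \<alpha> N w) ** matrix_inv L ** (L ** matrix_inv (P_minus a \<alpha> N z)) =
      matrix_inv (P_plus a \<alpha> N w) ** (matrix_inv L ** L) ** matrix_inv (P_minus a \<alpha> N z)"
    by (simp only: matrix_mul_assoc)
  then show ?thesis
    by (simp add: wiener_hopf_factors assms minus plus mscale_mult_right matrix_inv_mult L s_def)
qed

subsection \<open>The integrands of the kernel\<close>

lemma mat_holomorphic_mprod_A_step:
  "mat_holomorphic_on (\<lambda>z. mprod (\<lambda>k. A_step a \<alpha> k z) ks) (annulus a)"
proof (rule mat_holomorphic_on_mprod)
  fix k :: int
  have "mat_holomorphic_on (A_odd a \<alpha>) (annulus a)"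
    by (rule mat_holomorphic_onI) (auto simp: A_odd_def intro!: holomorphic_intros)
  moreover have "mat_holomorphic_on (A_even a) (annulus a)"
    unfolding A_even_def[abs_def] A_even_num_def
    by (intro mat_holomorphic_on_mscale mat_holomorphic_onI)
       (use outside_nonzero in \<open>auto simp: annulus_def intro!: holomorphic_intros\<close>)
  ultimately show "mat_holomorphic_on (A_step a \<alpha> k) (annulus a)"
    by (cases "odd k") (simp_all add: A_step_def[abs_def])
qed

lemma scalar_power_eq:
  assumes "z \<in> annulus a"
  shows "(1 / (1 - of_real (a\<^sup>2) / z)) ^ n = z powi int n / (z - of_real (a\<^sup>2)) powi int n"
proof -
  have "1 / (1 - of_real (a\<^sup>2) / z) = z / (z - of_real (a\<^sup>2))"
    using assms outside_nonzero[of z] by (simp add: annulus_def field_simps)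
  then show ?thesis
    by (simp add: power_int_def power_divide)
qed

lemma single_integrand_eq:
  assumes "z \<in> annulus a" "\<epsilon> \<in> {0, 1}" "\<epsilon>' \<in> {0, 1}" "2 * m' + \<epsilon>' < 2 * m + \<epsilon>"
  shows "(1 / z powi (x - x' + 1)) *m mprod (\<lambda>k. A_step a \<alpha> k z) [2 * m' + \<epsilon>' + 1..2 * m + \<epsilon>] =
    (z powi (m - x - m' + x') / (z - of_real (a\<^sup>2)) powi (m - m') * (1 / z)) *m
      (mpowi (A_odd a \<alpha> z) (- \<epsilon>') ** mpowi (P_mat a \<alpha> z) (m - m') ** mpowi (A_odd a \<alpha> z) \<epsilon>)"
proof -
  have "m' \<le> m"
    using assms(2-4) by auto
  then obtain n where m: "m = m' + int n"
    by (metis zle_iff_zadd)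
  have z: "z \<noteq> 0" "of_real (a\<^sup>2) * z \<noteq> 1"
    using assms(1) outside_nonzero inside_nonzero by (auto simp: annulus_def)
  have "mprod (\<lambda>k. A_step a \<alpha> k z) [2 * m' + \<epsilon>' + 1..2 * m + \<epsilon>] =
      (z powi int n / (z - of_real (a\<^sup>2)) powi int n) *m
        (mpowi (A_odd a \<alpha> z) (- \<epsilon>') ** mpow (P_mat a \<alpha> z) n ** mpowi (A_odd a \<alpha> z) \<epsilon>)"
    unfolding m scalar_power_eq[OF assms(1), symmetric]
    using alpha z assms by (intro mprod_A_step) (auto simp: m)
  moreover have "z powi (m - x - m' + x') * z powi (x - x' + 1) = z powi (int n + 1)"
    using z by (simp add: m flip: power_int_add)
  then have "z powi (m - x - m' + x') * z powi (x - x' + 1) = z powi int n * z"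
    by (simp only: power_int_add_1[OF disjI1[OF z(1)]])
  then have "1 / z powi (x - x' + 1) * (z powi int n / (z - of_real (a\<^sup>2)) powi int n) =
      z powi (m - x - m' + x') / (z - of_real (a\<^sup>2)) powi int n * (1 / z)"
    using z by (simp add: divide_simps)
  ultimately show ?thesis
    by (simp add: mscale_mscale m mpowi_nonneg)
qed

text \<open>Both double integrals have the integrand \<open>W Z / (z - w)\<close>, in which \<open>W\<close> depends only on \<open>w\<close> and \<open>Z\<close> only
  on \<open>z\<close>. This form is the one to which the change of radii applies.\<close>

lemma double_integrand_eq:
  fixes x x' m m' \<epsilon> \<epsilon>' :: int
  assumes wz: "w \<in> annulus a" "z \<in> annulus a"
    and range: "\<epsilon> \<in> {0, 1}" "\<epsilon>' \<in> {0, 1}" "0 \<le> m" "m \<le> int N" "2 * m' + \<epsilon>' \<le> 2 * int N"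
  defines "W \<equiv> w powi x' *m (mprod (\<lambda>k. A_step a \<alpha> k w) [2 * m' + \<epsilon>' + 1..2 * int N] **
      matrix_inv (P_plus a \<alpha> N w))"
    and "Z \<equiv> ((1 - of_real (a\<^sup>2) / z) ^ N / z powi (x + 1)) *m
      (matrix_inv (P_minus a \<alpha> N z) ** mprod (\<lambda>k. A_step a \<alpha> k z) [1..2 * m + \<epsilon>])"
  shows "(w powi x' / z powi (x + 1) * (1 / (z - w))) *m
        (mprod (\<lambda>k. A_step a \<alpha> k w) [2 * m' + \<epsilon>' + 1..2 * int N] **
         matrix_inv (A_plus a \<alpha> N w) ** matrix_inv (A_minus a \<alpha> N z) **
         mprod (\<lambda>k. A_step a \<alpha> k z) [1..2 * m + \<epsilon>]) = (1 / (z - w)) *m (W ** Z)"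
    and "(w powi (x' + int N - m') * (z - of_real (a\<^sup>2)) powi (int N - m) /
          (z powi (x + int N - m) * (w - of_real (a\<^sup>2)) powi (int N - m')) * (1 / (z * (z - w)))) *m
        (mpowi (A_odd a \<alpha> w) (- \<epsilon>') ** mpowi (P_mat a \<alpha> w) (int N - m') **
         matrix_inv (P_plus a \<alpha> N w) ** matrix_inv (P_minus a \<alpha> N z) **
         mpowi (P_mat a \<alpha> z) m ** mpowi (A_odd a \<alpha> z) \<epsilon>) = (1 / (z - w)) *m (W ** Z)"
proof -
  define T where "T = mprod (\<lambda>k. A_step a \<alpha> k w) [2 * m' + \<epsilon>' + 1..2 * int N]"
  define T' where "T' = mprod (\<lambda>k. A_step a \<alpha> k z) [1..2 * m + \<epsilon>]"
  have "T ** matrix_inv (A_plus a \<alpha> N w) ** matrix_inv (A_minus a \<alpha> N z) ** T' =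
      T ** (matrix_inv (A_plus a \<alpha> N w) ** matrix_inv (A_minus a \<alpha> N z)) ** T'"
    by (simp only: matrix_mul_assoc)
  then show "(w powi x' / z powi (x + 1) * (1 / (z - w))) *m
      (T ** matrix_inv (A_plus a \<alpha> N w) ** matrix_inv (A_minus a \<alpha> N z) ** T') =
      (1 / (z - w)) *m (W ** Z)"
    unfolding W_def Z_def T_def[symmetric] T'_def[symmetric] inverse_wiener_hopf_factors[OF wz]
    by (simp add: mscale_simps matrix_mul_assoc mult_ac)
next
  have "m' \<le> int N"
    using range by auto
  obtain n where m: "m = int n"
    using range(3) by (metis nonneg_int_cases)
  obtain n' where m': "int N = m' + int n'"
    using \<open>m' \<le> int N\<close> by (metis zle_iff_zadd)
  obtain d where d: "N = n + d"
    using range(4) m by (metis le_iff_add of_nat_le_iff)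
  have nz: "w \<noteq> 0" "w \<noteq> of_real (a\<^sup>2)" "z \<noteq> 0" "z \<noteq> of_real (a\<^sup>2)"
    "of_real (a\<^sup>2) * w \<noteq> 1" "of_real (a\<^sup>2) * z \<noteq> 1"
    using wz outside_nonzero[of w] outside_nonzero[of z] inside_nonzero[of w] inside_nonzero[of z]
    by (auto simp: annulus_def)
  have T: "mprod (\<lambda>k. A_step a \<alpha> k w) [2 * m' + \<epsilon>' + 1..2 * int N] =
      (w powi int n' / (w - of_real (a\<^sup>2)) powi int n') *m
        (mpowi (A_odd a \<alpha> w) (- \<epsilon>') ** mpow (P_mat a \<alpha> w) n')"
    using mprod_A_step[of \<alpha> a w 0 \<epsilon>' n' m'] alpha nz range
    unfolding m' scalar_power_eq[OF wz(1)] by simp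
  have T': "mprod (\<lambda>k. A_step a \<alpha> k z) [1..2 * m + \<epsilon>] =
      (z powi int n / (z - of_real (a\<^sup>2)) powi int n) *m
        (mpow (P_mat a \<alpha> z) n ** mpowi (A_odd a \<alpha> z) \<epsilon>)"
    using mprod_A_step[of \<alpha> a z \<epsilon> 0 n 0] alpha nz range
    unfolding m scalar_power_eq[OF wz(2)] by auto
  have "(1 - of_real (a\<^sup>2) / z) ^ N = (z - of_real (a\<^sup>2)) ^ n * (z - of_real (a\<^sup>2)) ^ d / (z ^ n * z ^ d)"
    using nz by (simp add: d power_add diff_divide_eq_iff power_divide)
  then have E1: "(1 - of_real (a\<^sup>2) / z) ^ N * (z powi int n / (z - of_real (a\<^sup>2)) powi int n) =
      (z - of_real (a\<^sup>2)) powi (int N - m) / z powi (int N - m)"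
    using nz by (simp add: m d)
  have E2: "w powi x' * w powi int n' = w powi (x' + int N - m')"
    using nz by (simp add: m' power_int_add)
  have E3: "z powi (int N - m) * z powi (x + 1) = z powi (x + int N - m) * z"
  proof -
    have "z powi (int N - m) * z powi (x + 1) = z powi (x + int N - m + 1)"
      using nz by (simp add: algebra_simps flip: power_int_add)
    then show ?thesis
      by (simp only: power_int_add_1[OF disjI1[OF nz(3)]])
  qed
  \<comment> \<open>The point \<open>z = w\<close> is not excluded, so the factor \<open>1 / (z - w)\<close> is carried along unchanged.\<close>
  have "1 / (z - w) * (w powi x' * (w powi int n' / (w - of_real (a\<^sup>2)) powi int n') *
        ((1 - of_real (a\<^sup>2) / z) ^ N / z powi (x + 1) * (z powi int n / (z - of_real (a\<^sup>2)) powi int n))) =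
      1 / (z - w) * ((w powi x' * w powi int n') / (w - of_real (a\<^sup>2)) powi int n' *
        ((1 - of_real (a\<^sup>2) / z) ^ N * (z powi int n / (z - of_real (a\<^sup>2)) powi int n) / z powi (x + 1)))"
    by simp
  also have "\<dots> = 1 / (z - w) * (w powi (x' + int N - m') / (w - of_real (a\<^sup>2)) powi int n' *
        ((z - of_real (a\<^sup>2)) powi (int N - m) / (z powi (int N - m) * z powi (x + 1))))"
    unfolding E1 E2 divide_divide_eq_left ..
  also have "\<dots> = w powi (x' + int N - m') * (z - of_real (a\<^sup>2)) powi (int N - m) /
      (z powi (x + int N - m) * (w - of_real (a\<^sup>2)) powi (int N - m')) * (1 / (z * (z - w)))"
    unfolding E3 by (simp add: m')
  finally have scalar: "w powi (x' + int N - m') * (z - of_real (a\<^sup>2)) powi (int N - m) /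
      (z powi (x + int N - m) * (w - of_real (a\<^sup>2)) powi (int N - m')) * (1 / (z * (z - w))) =
      1 / (z - w) * (w powi x' * (w powi int n' / (w - of_real (a\<^sup>2)) powi int n') *
        ((1 - of_real (a\<^sup>2) / z) ^ N / z powi (x + 1) * (z powi int n / (z - of_real (a\<^sup>2)) powi int n)))"
    by (rule sym)
  have powers: "mpowi (P_mat a \<alpha> w) (int N - m') = mpow (P_mat a \<alpha> w) n'"
      "mpowi (P_mat a \<alpha> z) m = mpow (P_mat a \<alpha> z) n"
    by (simp_all add: m m' mpowi_nonneg)
  show "(w powi (x' + int N - m') * (z - of_real (a\<^sup>2)) powi (int N - m) /
          (z powi (x + int N - m) * (w - of_real (a\<^sup>2)) powi (int N - m')) * (1 / (z * (z - w)))) *m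
        (mpowi (A_odd a \<alpha> w) (- \<epsilon>') ** mpowi (P_mat a \<alpha> w) (int N - m') **
         matrix_inv (P_plus a \<alpha> N w) ** matrix_inv (P_minus a \<alpha> N z) **
         mpowi (P_mat a \<alpha> z) m ** mpowi (A_odd a \<alpha> z) \<epsilon>) = (1 / (z - w)) *m (W ** Z)"
    unfolding scalar powers W_def Z_def T T'
    by (simp only: mscale_simps matrix_mul_assoc mult_ac)
qed

lemma mat_holomorphic_integrand_factors:
  "mat_holomorphic_on (\<lambda>w. w powi x' *m (mprod (\<lambda>k. A_step a \<alpha> k w) ks **
      matrix_inv (P_plus a \<alpha> N w))) (annulus a)"
  "mat_holomorphic_on (\<lambda>z. ((1 - of_real (a\<^sup>2) / z) ^ N / z powi (x + 1)) *m
      (matrix_inv (P_minus a \<alpha> N z) ** mprod (\<lambda>k. A_step a \<alpha> k z) ks)) (annulus a)"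
proof -
  have nz: "z \<noteq> 0" "z \<noteq> of_real (a\<^sup>2)" "of_real (a\<^sup>2) * z \<noteq> 1" if "z \<in> annulus a" for z
    using that outside_nonzero[of z] inside_nonzero[of z] by (auto simp: annulus_def)
  have plus: "mat_holomorphic_on (\<lambda>w. matrix_inv (P_plus a \<alpha> N w)) (annulus a)"
    using a alpha nz by (intro mat_holomorphic_on_matrix_inv mat_holomorphic_P_plus det_P_plus_nonzero)
  have minus: "mat_holomorphic_on (\<lambda>z. matrix_inv (P_minus a \<alpha> N z)) (annulus a)"
    using a alpha nz by (intro mat_holomorphic_on_matrix_inv mat_holomorphic_P_minus det_P_minus_nonzero) auto
  have scalar_plus: "(\<lambda>w. w powi x') holomorphic_on annulus a"
    using nz(1) by (intro holomorphic_intros) auto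
  have scalar_minus: "(\<lambda>z. (1 - of_real (a\<^sup>2) / z) ^ N / z powi (x + 1)) holomorphic_on annulus a"
    using nz(1) by (intro holomorphic_intros) (auto simp: power_int_eq_0_iff)
  show "mat_holomorphic_on (\<lambda>w. w powi x' *m (mprod (\<lambda>k. A_step a \<alpha> k w) ks **
      matrix_inv (P_plus a \<alpha> N w))) (annulus a)"
    "mat_holomorphic_on (\<lambda>z. ((1 - of_real (a\<^sup>2) / z) ^ N / z powi (x + 1)) *m
      (matrix_inv (P_minus a \<alpha> N z) ** mprod (\<lambda>k. A_step a \<alpha> k z) ks)) (annulus a)"
    by (intro mat_holomorphic_on_mscale mat_holomorphic_on_mult mat_holomorphic_mprod_A_step
        plus minus scalar_plus scalar_minus)+
qed

end

theorem theorem3p1: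
  fixes a \<alpha> r\<^sub>1 r\<^sub>2 \<rho>\<^sub>1 \<rho>\<^sub>2 :: real and N :: nat and x x' m m' \<epsilon> \<epsilon>' j j' :: int
  assumes "0 < a" "a < 1" "0 < \<alpha>" "\<alpha> \<le> 1" "N \<ge> 1"
    and "a\<^sup>2 < r\<^sub>1" "r\<^sub>1 < r\<^sub>2" "r\<^sub>2 < 1 / a\<^sup>2"
    and "a\<^sup>2 < \<rho>\<^sub>1" "\<rho>\<^sub>1 < \<rho>\<^sub>2" "\<rho>\<^sub>2 < 1 / a\<^sup>2"
    and "\<epsilon> \<in> {0, 1}" "\<epsilon>' \<in> {0, 1}"
    and "0 \<le> 2 * m + \<epsilon>" "2 * m + \<epsilon> \<le> 2 * int N"
    and "0 \<le> 2 * m' + \<epsilon>'" "2 * m' + \<epsilon>' \<le> 2 * int N"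
    and "j \<in> {0, 1}" "j' \<in> {0, 1}"
  shows "corr_kernel a \<alpha> N r\<^sub>1 r\<^sub>2 (2 * m + \<epsilon>, 2 * x - j) (2 * m' + \<epsilon>', 2 * x' - j') =
    (- ((of_bool (2 * m' + \<epsilon>' < 2 * m + \<epsilon>) / (2 * of_real pi * \<i>)) *m
          circle_int 1 (\<lambda>z.
            (z powi (m - x - m' + x') / (z - of_real (a\<^sup>2)) powi (m - m') * (1 / z)) *m
              (mpowi (A_odd a \<alpha> z) (- \<epsilon>') ** mpowi (P_mat a \<alpha> z) (m - m') **
               mpowi (A_odd a \<alpha> z) \<epsilon>)))
     + (1 / (2 * of_real pi * \<i>)\<^sup>2) *m
          circle_int \<rho>\<^sub>1 (\<lambda>w. circle_int \<rho>\<^sub>2 (\<lambda>z.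
            (w powi (x' + int N - m') * (z - of_real (a\<^sup>2)) powi (int N - m) /
               (z powi (x + int N - m) * (w - of_real (a\<^sup>2)) powi (int N - m')) *
               (1 / (z * (z - w)))) *m
              (mpowi (A_odd a \<alpha> w) (- \<epsilon>') ** mpowi (P_mat a \<alpha> w) (int N - m') **
               matrix_inv (P_plus a \<alpha> N w) ** matrix_inv (P_minus a \<alpha> N z) **
               mpowi (P_mat a \<alpha> z) m ** mpowi (A_odd a \<alpha> z) \<epsilon>)))) $ ix j' $ ix j"
proof -
  have a: "0 < a" "a < 1" and alpha: "0 < \<alpha>"
    by fact+
  have range: "\<epsilon> \<in> {0, 1}" "\<epsilon>' \<in> {0, 1}" "0 \<le> m" "m \<le> int N" "2 * m' + \<epsilon>' \<le> 2 * int N"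
    using assms by auto
  have "0 < a\<^sup>2"
    using a by simp
  then have pos: "0 < r\<^sub>1" "0 < r\<^sub>2" "0 < \<rho>\<^sub>1" "0 < \<rho>\<^sub>2"
    using assms by linarith+
  have on_annulus: "z \<in> annulus a" if "cmod z \<in> {r\<^sub>1, r\<^sub>2, \<rho>\<^sub>1, \<rho>\<^sub>2}" for z
    using that assms by (auto simp: annulus_def)
  define U where "U = (\<lambda>w. w powi x' *m
      (mprod (\<lambda>k. A_step a \<alpha> k w) [2 * m' + \<epsilon>' + 1..2 * int N] ** matrix_inv (P_plus a \<alpha> N w)))"
  define V where "V = (\<lambda>z. ((1 - of_real (a\<^sup>2) / z) ^ N / z powi (x + 1)) *m
      (matrix_inv (P_minus a \<alpha> N z) ** mprod (\<lambda>k. A_step a \<alpha> k z) [1..2 * m + \<epsilon>]))"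
  note integrand = double_integrand_eq[OF a alpha _ _ range, where x = x and x' = x']
  have single: "(of_bool (2 * m' + \<epsilon>' < 2 * m + \<epsilon>) / (2 * of_real pi * \<i>)) *m
      circle_int 1 (\<lambda>z. (1 / z powi (x - x' + 1)) *m
        mprod (\<lambda>k. A_step a \<alpha> k z) [2 * m' + \<epsilon>' + 1..2 * m + \<epsilon>]) =
    (of_bool (2 * m' + \<epsilon>' < 2 * m + \<epsilon>) / (2 * of_real pi * \<i>)) *m
      circle_int 1 (\<lambda>z. (z powi (m - x - m' + x') / (z - of_real (a\<^sup>2)) powi (m - m') * (1 / z)) *m
        (mpowi (A_odd a \<alpha> z) (- \<epsilon>') ** mpowi (P_mat a \<alpha> z) (m - m') ** mpowi (A_odd a \<alpha> z) \<epsilon>))"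
  proof (cases "2 * m' + \<epsilon>' < 2 * m + \<epsilon>")
    case True
    show ?thesis
      by (rule arg_cong[OF circle_int_cong])
         (simp, rule single_integrand_eq[OF a alpha unit_circle_annulus[OF a alpha] range(1,2) True])
  next
    \<comment> \<open>For \<open>m < m'\<close> the right-hand integrand contains inverses of \<open>P\<close>, but the indicator removes the integral.\<close>
    case False
    then show ?thesis
      by (simp add: cmat_eq_iff)
  qed
  have "circle_int r\<^sub>1 (\<lambda>w. circle_int r\<^sub>2 (\<lambda>z. (w powi x' / z powi (x + 1) * (1 / (z - w))) *m
        (mprod (\<lambda>k. A_step a \<alpha> k w) [2 * m' + \<epsilon>' + 1..2 * int N] **
         matrix_inv (A_plus a \<alpha> N w) ** matrix_inv (A_minus a \<alpha> N z) **
         mprod (\<lambda>k. A_step a \<alpha> k z) [1..2 * m + \<epsilon>]))) =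
      circle_int r\<^sub>1 (\<lambda>w. circle_int r\<^sub>2 (\<lambda>z. (1 / (z - w)) *m (U w ** V z)))"
    unfolding U_def V_def by (intro circle_int_cong integrand(1) on_annulus pos) simp_all
  also have "\<dots> = circle_int \<rho>\<^sub>1 (\<lambda>w. circle_int \<rho>\<^sub>2 (\<lambda>z. (1 / (z - w)) *m (U w ** V z)))"
  proof (rule double_circle_int_radii)
    show "mat_holomorphic_on U {z. a\<^sup>2 < cmod z \<and> cmod z < 1 / a\<^sup>2}"
      "mat_holomorphic_on V {z. a\<^sup>2 < cmod z \<and> cmod z < 1 / a\<^sup>2}"
      unfolding U_def V_def annulus_def[symmetric]
      by (rule mat_holomorphic_integrand_factors[OF a alpha])+
  qed (use assms in simp_all)
  also have "\<dots> = circle_int \<rho>\<^sub>1 (\<lambda>w. circle_int \<rho>\<^sub>2 (\<lambda>z.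
            (w powi (x' + int N - m') * (z - of_real (a\<^sup>2)) powi (int N - m) /
               (z powi (x + int N - m) * (w - of_real (a\<^sup>2)) powi (int N - m')) *
               (1 / (z * (z - w)))) *m
              (mpowi (A_odd a \<alpha> w) (- \<epsilon>') ** mpowi (P_mat a \<alpha> w) (int N - m') **
               matrix_inv (P_plus a \<alpha> N w) ** matrix_inv (P_minus a \<alpha> N z) **
               mpowi (P_mat a \<alpha> z) m ** mpowi (A_odd a \<alpha> z) \<epsilon>)))"
    unfolding U_def V_def by (intro circle_int_cong integrand(2)[symmetric] on_annulus pos) simp_all
  finally have double: "circle_int r\<^sub>1 (\<lambda>w. circle_int r\<^sub>2 (\<lambda>z. (w powi x' / z powi (x + 1) * (1 / (z - w))) *m
        (mprod (\<lambda>k. A_step a \<alpha> k w) [2 * m' + \<epsilon>' + 1..2 * int N] **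
         matrix_inv (A_plus a \<alpha> N w) ** matrix_inv (A_minus a \<alpha> N z) **
         mprod (\<lambda>k. A_step a \<alpha> k z) [1..2 * m + \<epsilon>]))) = \<dots>" .
  \<comment> \<open>The two columns \<open>u = 2 x - j\<close> of a block are decoded to \<open>x\<close> and \<open>j\<close>.\<close>
  have parity: "(2 * y - i + 1) div 2 = y" "(2 * y - i) mod 2 = i" if "i \<in> {0, 1}" for y i :: int
  proof -
    from that have "i = 0 \<or> i = 1"
      by simp
    then show "(2 * y - i + 1) div 2 = y" "(2 * y - i) mod 2 = i"
      by presburger+
  qed
  show ?thesis
    unfolding corr_kernel_def kernel_block_def prod.case
      parity[OF assms(18)] parity[OF assms(19)] single double ..
qed

end
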